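(* Let $(X_1,\dots,X_n)$ be i.i.d. with joint distribution $P_{n,\xi_n,\theta_n}$, where $\xi_n=\xi_0+\delta_1 n^{-1/4}$ and $\theta_n=\theta+\delta_2 n^{-1/2}$. Suppose the density $p(x;\xi,\theta)$ satisfies Assumption 1 and the modified DQM condition at $(\xi_0,\theta)$ (both given in the context) with $$v(x)=(v_\xi(x),v_\theta^\top(x))^\top=\left(\frac14\frac{\nabla_\xi^2 p(x;\xi_0,\theta)}{\sqrt{p(x;\xi_0,\theta)}}\mathbb{I}_{[p(x;\xi_0,\theta)>0]},\ \frac12\frac{\nabla_\theta p(x;\xi_0,\theta)^\top}{\sqrt{p(x;\xi_0,\theta)}}\mathbb{I}_{[p(x;\xi_0,\theta)>0]}\right)^\top .$$ Then for fixed $\delta_1\in\mathbb{R}$ and $\delta_2\in\mathbb{R}^p$, the log-likelihood ratio has the following quadratic approximation under the null (i.e. under $P_{n,\xi_0,\theta}$): $$\Lambda_n=\log\frac{dP_{n,\xi_n,\theta_n}}{dP_{n,\xi_0,\theta}}=t^\top S_n-\tfrac12 t^\top J t+o_P(1),$$ where $t=(\delta_1^2,\delta_2^\top)^\top$, $$S_n=(S_{\xi,n},S_{\theta,n}^\top)^\top=\left(\frac{2}{\sqrt n}\sum_{i=1}^n\frac{v_\xi(X_i)}{\sqrt{p(X_i;\xi_0,\theta)}},\ \frac{2}{\sqrt n}\sum_{i=1}^n\frac{v_\theta^\top(X_i)}{\sqrt{p(X_i;\xi_0,\theta)}}\right)^\top$$ and $$J=4\int vv^\top\,d\mu(x)=\begin{pmatrix}\mathbb{E}(S_{\xi,n}^2)&\mathrm{Cov}(S_{\xi,n},S_{\theta,n}^\top)\\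 \mathrm{Cov}(S_{\xi,n},S_{\theta,n})&\mathbb{E}(S_{\theta,n}S_{\theta,n}^\top)\end{pmatrix}\equiv\begin{pmatrix}J_{\xi\xi}&J_{\xi\theta}\\ J_{\theta\xi}&J_{\theta\theta}\end{pmatrix},$$ with expectations and covariances taken under the null.
   Context: Setting. $X_1,\dots,X_n$ is a random sample with density $p(x;\xi,\theta)$ with respect to a measure $\mu$; $P_{n,\xi,\theta}$ denotes the joint distribution, the product of $n$ copies of the marginal distribution. Here $\xi\in\Xi\subset\mathbb{R}$ is the parameter under test, with null value $\xi_0$, and $\theta\in\Theta\subset\mathbb{R}^p$ is a vector of nuisance parameters. Assumption 1. (1) $\xi_0$ is an interior point of $\Xi$. (2) For all $\theta\in\Theta\subset\mathbb{R}^p$ and $\xi\in\Xi\subset\mathbb{R}$, the density is twice continuously differentiable with respect to $\xi$ and once continuously differentiable with respect to $\theta$ for $\mu$-almost all $x$. (3) Denoting by $\nabla_\xi p(x;\xi_0,\theta)$ and $\nabla_\xi^2p(x;\xi_0,\theta)$ the first two derivatives of the density with respect to $\xi$ evaluated at $\xi_0$, $\mathbb{P}(\nabla_\xi p(x;\xi_0,\theta)=0)=1$ and $\mathbb{P}(\nabla_\xi^2 p(x;\xi_0,\theta)\neq0)>0$ for all $\theta\in\Theta$. (4) Denoting by $\nabla_\theta p(x;\xi_0,\theta)$ the derivative with respect to $\theta$ evaluated under the null, for any $p$-dimensional vector $a$, $\mathbb{P}(\nabla_\xi^2p(x;\xi_0,\theta)\neq a^\top\nabla_\theta p(x;\xi_0,\theta))>0$.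 Modified DQM condition. The density $p(x;\xi,\theta)$ satisfies the modified differentiability in quadratic mean (DQM) condition at $(\xi_0,\theta)$ if there exists a vector $v(x)=(v_\xi(x),v_\theta^\top(x))^\top\in\mathcal{L}_2(\mu)$ such that, as $(\xi_n,\theta_n)\to(\xi_0,\theta)$, $$\int\left|\sqrt{p(x;\xi_n,\theta_n)}-\sqrt{p(x;\xi_0,\theta)}-h_n^\top v(x)\right|^2d\mu(x)=o(\|h_n\|^2),\qquad h_n=((\xi_n-\xi_0)^2,(\theta_n-\theta)^\top)^\top,$$ where $\|\cdot\|$ is the Euclidean norm and $\mathcal{L}_2(\mu)$ is the space of functions square integrable with respect to $\mu$; furthermore, letting $\beta(h_n)$ be the mass of the part of $p(x;\xi_n,\theta_n)$ that is $p(x;\xi_0,\theta)$-singular, $\beta(h_n)/\|h_n\|^2\to0$ as $(\xi_n,\theta_n)\to(\xi_0,\theta)$. *)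

theory Defs
  imports "HOL-Probability.Probability" "HOL-Library.Landau_Symbols"
begin

section \<open>The statistical model\<close>

definition marginal :: "'x measure \<Rightarrow> ('x \<Rightarrow> real \<Rightarrow> real^'p \<Rightarrow> real) \<Rightarrow> real \<Rightarrow> real^'p \<Rightarrow> 'x measure" where
  "marginal \<mu> p \<xi> \<theta> = density \<mu> (\<lambda>x. ennreal (p x \<xi> \<theta>))"

text \<open>The sample is the coordinate process: the observation \<open>X\<^sub>i\<close> is \<open>\<lambda>\<omega>. \<omega> i\<close> for \<open>i < n\<close>.\<close>

definition joint :: "'x measure \<Rightarrow> ('x \<Rightarrow> real \<Rightarrow> real^'p \<Rightarrow> real) \<Rightarrow> nat \<Rightarrow> real \<Rightarrow> real^'p \<Rightarrow> (nat \<Rightarrow> 'x) measure" where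
  "joint \<mu> p n \<xi> \<theta> = Pi\<^sub>M {..<n} (\<lambda>_. marginal \<mu> p \<xi> \<theta>)"

definition density_family ::
  "'x measure \<Rightarrow> ('x \<Rightarrow> real \<Rightarrow> real^'p \<Rightarrow> real) \<Rightarrow> real set \<Rightarrow> (real^'p) set \<Rightarrow> bool" where
  "density_family \<mu> p \<Xi> \<Theta> \<longleftrightarrow>
     (\<forall>\<xi>\<in>\<Xi>. \<forall>\<theta>\<in>\<Theta>. (\<lambda>x. p x \<xi> \<theta>) \<in> borel_measurable \<mu> \<and> (\<forall>x\<in>space \<mu>. 0 \<le> p x \<xi> \<theta>) \<and>
        prob_space (marginal \<mu> p \<xi> \<theta>))"


section \<open>Smoothness of the density\<close>

text \<open>
  Derivatives are taken within the parameter set, which need not be open, and are supplied as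
  functions: \<open>f'\<close>, \<open>f''\<close> below are derivatives and \<open>g\<close> is a gradient.
  Both predicates are local (on a neighbourhood of the point within the parameter set), so that
  the exceptional null set of sample points may depend on the parameter value.
\<close>

definition twice_cont_diff_near ::
  "(real \<Rightarrow> real) \<Rightarrow> (real \<Rightarrow> real) \<Rightarrow> (real \<Rightarrow> real) \<Rightarrow> real set \<Rightarrow> real \<Rightarrow> bool" where
  "twice_cont_diff_near f f' f'' S a \<longleftrightarrow>
     (\<exists>U. open U \<and> a \<in> U \<and>
        (\<forall>b\<in>U \<inter> S. (f has_real_derivative f' b) (at b within S) \<and>
                    (f' has_real_derivative f'' b) (at b within S)) \<and>
        continuous_on (U \<inter> S) f'')"

definition cont_diff_near ::
  "(real^'p \<Rightarrow> real) \<Rightarrow> (real^'p \<Rightarrow> real^'p) \<Rightarrow> (real^'p) set \<Rightarrow> real^'p \<Rightarrow> bool" where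
  "cont_diff_near f g S a \<longleftrightarrow>
     (\<exists>U. open U \<and> a \<in> U \<and>
        (\<forall>b\<in>U \<inter> S. (f has_derivative (\<lambda>h. g b \<bullet> h)) (at b within S)) \<and>
        continuous_on (U \<inter> S) g)"

text \<open>
  The functions \<open>p1\<close>, \<open>p2\<close> are the first two derivatives of the density in \<open>\<xi>\<close> and \<open>g\<close> is its
  gradient in \<open>\<theta>\<close>.  The probabilities in the last two clauses are under the null distribution
  with parameter \<open>(\<xi>0, \<theta>)\<close>; \<open>\<not> (AE x in P. \<not> A x)\<close> says that \<open>A\<close> has positive probability,
  and is also meaningful when the derivatives, which are determined only almost everywhere,
  are not measurable.
\<close>

definition regularity ::
  "'x measure \<Rightarrow> ('x \<Rightarrow> real \<Rightarrow> real^'p \<Rightarrow> real) \<Rightarrow> ('x \<Rightarrow> real \<Rightarrow> real^'p \<Rightarrow> real) \<Rightarrow>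
   ('x \<Rightarrow> real \<Rightarrow> real^'p \<Rightarrow> real) \<Rightarrow> ('x \<Rightarrow> real \<Rightarrow> real^'p \<Rightarrow> real^'p) \<Rightarrow>
   real set \<Rightarrow> (real^'p) set \<Rightarrow> real \<Rightarrow> bool" where
  "regularity \<mu> p p1 p2 g \<Xi> \<Theta> \<xi>0 \<longleftrightarrow>
     \<xi>0 \<in> interior \<Xi> \<and>
     (\<forall>\<theta>\<in>\<Theta>. \<forall>\<xi>\<in>\<Xi>. AE x in \<mu>.
        twice_cont_diff_near (\<lambda>\<xi>'. p x \<xi>' \<theta>) (\<lambda>\<xi>'. p1 x \<xi>' \<theta>) (\<lambda>\<xi>'. p2 x \<xi>' \<theta>) \<Xi> \<xi> \<and>
        cont_diff_near (\<lambda>\<theta>'. p x \<xi> \<theta>') (\<lambda>\<theta>'. g x \<xi> \<theta>') \<Theta> \<theta>) \<and>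
     (\<forall>\<theta>\<in>\<Theta>. (AE x in marginal \<mu> p \<xi>0 \<theta>. p1 x \<xi>0 \<theta> = 0) \<and>
              \<not> (AE x in marginal \<mu> p \<xi>0 \<theta>. p2 x \<xi>0 \<theta> = 0)) \<and>
     (\<forall>\<theta>\<in>\<Theta>. \<forall>a. \<not> (AE x in marginal \<mu> p \<xi>0 \<theta>. p2 x \<xi>0 \<theta> = a \<bullet> g x \<xi>0 \<theta>))"


section \<open>Modified differentiability in quadratic mean\<close>

text \<open>
  Vectors of dimension \<open>1 + p\<close> are indexed by \<^typ>\<open>'p option\<close>: the index \<^const>\<open>None\<close> is
  the \<open>\<xi>\<close>-component and \<open>Some j\<close> is the \<open>j\<close>-th \<open>\<theta>\<close>-component.
\<close>

definition block :: "real \<Rightarrow> real^'p \<Rightarrow> real^('p option)" where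
  "block a b = (\<chi> i. case i of None \<Rightarrow> a | Some j \<Rightarrow> b $ j)"

text \<open>
  The mass of the part of the \<open>(\<xi>, \<theta>)\<close>-distribution that is singular to the
  \<open>(\<xi>0, \<theta>0)\<close>-distribution; this part is the restriction to the zero set of the density at
  \<open>(\<xi>0, \<theta>0)\<close>.
\<close>

definition singular_mass ::
  "'x measure \<Rightarrow> ('x \<Rightarrow> real \<Rightarrow> real^'p \<Rightarrow> real) \<Rightarrow> real \<Rightarrow> real^'p \<Rightarrow> real \<Rightarrow> real^'p \<Rightarrow> real" where
  "singular_mass \<mu> p \<xi>0 \<theta>0 \<xi> \<theta> =
     measure (marginal \<mu> p \<xi> \<theta>) {x \<in> space \<mu>. p x \<xi>0 \<theta>0 = 0}"

definition modified_DQM ::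
  "'x measure \<Rightarrow> ('x \<Rightarrow> real \<Rightarrow> real^'p \<Rightarrow> real) \<Rightarrow> real set \<Rightarrow> (real^'p) set \<Rightarrow>
   real \<Rightarrow> real^'p \<Rightarrow> ('x \<Rightarrow> real^('p option)) \<Rightarrow> bool" where
  "modified_DQM \<mu> p \<Xi> \<Theta> \<xi>0 \<theta>0 v \<longleftrightarrow>
     v \<in> borel_measurable \<mu> \<and> integrable \<mu> (\<lambda>x. (norm (v x))\<^sup>2) \<and>
     (\<lambda>(\<xi>, \<theta>). LINT x|\<mu>. (sqrt (p x \<xi> \<theta>) - sqrt (p x \<xi>0 \<theta>0)
                              - block ((\<xi> - \<xi>0)\<^sup>2) (\<theta> - \<theta>0) \<bullet> v x)\<^sup>2)
       \<in> o[at (\<xi>0, \<theta>0) within \<Xi> \<times> \<Theta>](\<lambda>(\<xi>, \<theta>). (norm (block ((\<xi> - \<xi>0)\<^sup>2) (\<theta> - \<theta>0)))\<^sup>2) \<and>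
     ((\<lambda>(\<xi>, \<theta>). singular_mass \<mu> p \<xi>0 \<theta>0 \<xi> \<theta> / (norm (block ((\<xi> - \<xi>0)\<^sup>2) (\<theta> - \<theta>0)))\<^sup>2)
       \<longlongrightarrow> 0) (at (\<xi>0, \<theta>0) within \<Xi> \<times> \<Theta>)"


section \<open>Log-likelihood ratio\<close>

text \<open>
  \<open>lik_ratio P Q\<close> is \<open>dQ/dP\<close> in the usual sense for likelihood ratios: \<open>Q\<close> need not be absolutely
  continuous with respect to \<open>P\<close>, and the derivative is that of the absolutely continuous part in
  the Lebesgue decomposition of \<open>Q\<close>.  The null set \<open>N\<close> carries the singular part.
  (The constant \<^const>\<open>RN_deriv\<close> is unspecified in the absence of absolute continuity.)
\<close>

definition lik_ratio :: "'a measure \<Rightarrow> 'a measure \<Rightarrow> 'a \<Rightarrow> ennreal" where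
  "lik_ratio P Q = (SOME f. f \<in> borel_measurable P \<and>
     (\<exists>N\<in>null_sets P. \<forall>A\<in>sets P. emeasure Q A = emeasure (density P f) A + emeasure Q (A \<inter> N)))"

text \<open>Here \<open>log 0\<close> is \<open>-\<infinity>\<close>, unlike for \<^const>\<open>ln\<close> on the reals.\<close>

definition log_ennreal :: "ennreal \<Rightarrow> ereal" where
  "log_ennreal r = (if r = 0 then -\<infinity> else if r = \<top> then \<infinity> else ereal (ln (enn2real r)))"

definition log_lik_ratio ::
  "'x measure \<Rightarrow> ('x \<Rightarrow> real \<Rightarrow> real^'p \<Rightarrow> real) \<Rightarrow> nat \<Rightarrow> real \<Rightarrow> real^'p \<Rightarrow> real \<Rightarrow> real^'p \<Rightarrow>
   (nat \<Rightarrow> 'x) \<Rightarrow> ereal" where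
  "log_lik_ratio \<mu> p n \<xi>0 \<theta>0 \<xi> \<theta> =
     (\<lambda>\<omega>. log_ennreal (lik_ratio (joint \<mu> p n \<xi>0 \<theta>0) (joint \<mu> p n \<xi> \<theta>) \<omega>))"

text \<open>\<open>R n = o\<^sub>P(1)\<close> under \<open>P n\<close>.\<close>

definition small_o_prob :: "(nat \<Rightarrow> 'a measure) \<Rightarrow> (nat \<Rightarrow> 'a \<Rightarrow> ereal) \<Rightarrow> bool" where
  "small_o_prob P R \<longleftrightarrow>
     (\<forall>\<^sub>F n in sequentially. R n \<in> borel_measurable (P n)) \<and>
     (\<forall>\<epsilon>::real. 0 < \<epsilon> \<longrightarrow> (\<lambda>n. measure (P n) {\<omega> \<in> space (P n). \<bar>R n \<omega>\<bar> > ereal \<epsilon>}) \<longlonglongrightarrow> 0)"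


section \<open>Score and information\<close>

definition score ::
  "('x \<Rightarrow> real \<Rightarrow> real^'p \<Rightarrow> real) \<Rightarrow> real \<Rightarrow> real^'p \<Rightarrow> ('x \<Rightarrow> real^('p option)) \<Rightarrow> nat \<Rightarrow>
   (nat \<Rightarrow> 'x) \<Rightarrow> real^('p option)" where
  "score p \<xi>0 \<theta>0 v n \<omega> =
     (2 / sqrt (real n)) *\<^sub>R (\<Sum>i<n. (1 / sqrt (p (\<omega> i) \<xi>0 \<theta>0)) *\<^sub>R v (\<omega> i))"

definition information :: "'x measure \<Rightarrow> ('x \<Rightarrow> real^('p::finite option)) \<Rightarrow> real^('p option)^('p option)" where
  "information \<mu> v = (\<chi> i j. 4 * (LINT x|\<mu>. v x $ i * v x $ j))"

definition covariance :: "'a measure \<Rightarrow> ('a \<Rightarrow> real) \<Rightarrow> ('a \<Rightarrow> real) \<Rightarrow> real" where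
  "covariance P X Y = (LINT \<omega>|P. (X \<omega> - (LINT \<omega>'|P. X \<omega>')) * (Y \<omega> - (LINT \<omega>'|P. Y \<omega>')))"

end

theory Submission
  imports Defs
begin

text \<open>
  Put \<open>W\<^sub>i = 2 (\<surd>(q\<^sub>n/p\<^sub>0)(X\<^sub>i) - 1)\<close> and let \<open>U\<^sub>i\<close> be the contribution of \<open>X\<^sub>i\<close> to \<open>t \<bullet> S\<^sub>n\<close>. The parametrisation is chosen
  so that the DQM direction is exactly \<open>h\<^sub>n = t/\<surd>n\<close>, hence DQM says \<open>n E(W - U)\<^sup>2 \<longlonglongrightarrow> 0\<close>. Unit mass of the
  densities turns \<open>E W\<close> into minus the squared Hellinger distance, so \<open>n E W \<longlonglongrightarrow> - t \<bullet> J t / 4\<close>, and, one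
  power of \<open>\<surd>n\<close> lower, forces \<open>E U = 0\<close>. In the expansion \<open>2 log (1 + W/2) = W - W\<^sup>2/4 + O(\<bar>W\<bar>\<^sup>3)\<close> the linear terms
  sum to \<open>t \<bullet> S\<^sub>n - t \<bullet> J t / 4\<close> up to a vanishing variance, the squares obey a weak law with limit \<open>t \<bullet> J t\<close>,
  and the remainder is negligible. All errors are shown to vanish in \<open>L\<^sup>1\<close> of the product measure.
\<close>

subsection \<open>Square-integrable functions\<close>

text \<open>Only second moments are available, and this shapes three steps. Closeness of
  \<open>W\<close> and \<open>U\<close> in L2 fixes \<open>E W\<close> only up to o(n^(-1/2)),
  whereas a sum of n means requires o(1/n); the mean is therefore computed exactly from the unit
  masses. The squares of \<open>U\<close> need not have a variance, so their weak law goes through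
  truncation at \<open>\<bar>U\<bar> \<le> 1\<close>. The Taylor remainder is measured by a capped
  cube, which needs no third moment.

  Geometrically, square roots of densities lie on the unit sphere of L2(\<mu>), and DQM provides the
  tangent vector \<open>g = t \<bullet> v\<close> of a path through the square root of the null
  density. Tangency is the statement \<open>E U = 0\<close>; the curvature of the sphere is the
  shift of \<open>E W\<close>. The coefficient 1/2 of the quadratic term is a quarter from this
  shift plus a quarter from the squares.\<close>

lemma integrable_mult_L2:
  fixes f g :: "'a \<Rightarrow> real"
  assumes [measurable]: "f \<in> borel_measurable M" "g \<in> borel_measurable M"
    and f: "integrable M (\<lambda>x. (f x)\<^sup>2)" and g: "integrable M (\<lambda>x. (g x)\<^sup>2)"
  shows "integrable M (\<lambda>x. f x * g x)"
proof (rule Bochner_Integration.integrable_bound[of M "\<lambda>x. (f x)\<^sup>2 + (g x)\<^sup>2"])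
  show "AE x in M. norm (f x * g x) \<le> norm ((f x)\<^sup>2 + (g x)\<^sup>2)"
  proof (rule AE_I2)
    fix x
    have "0 \<le> (\<bar>f x\<bar> - \<bar>g x\<bar>)\<^sup>2" "0 \<le> \<bar>f x\<bar> * \<bar>g x\<bar>" by auto
    then show "norm (f x * g x) \<le> norm ((f x)\<^sup>2 + (g x)\<^sup>2)"
      unfolding real_norm_def abs_mult power2_diff power2_abs by linarith
  qed
qed (use f g in auto)

lemma integrable_add_L2:
  fixes f g :: "'a \<Rightarrow> real"
  assumes [measurable]: "f \<in> borel_measurable M" "g \<in> borel_measurable M"
    and f: "integrable M (\<lambda>x. (f x)\<^sup>2)" and g: "integrable M (\<lambda>x. (g x)\<^sup>2)"
  shows "integrable M (\<lambda>x. (f x + g x)\<^sup>2)" "integrable M (\<lambda>x. (f x - g x)\<^sup>2)"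
  using integrable_mult_L2[OF assms] f g
  by (auto simp: power2_sum power2_diff mult.assoc)

text \<open>The integral of \<open>(f - c / G * g)\<^sup>2\<close> is nonnegative, where
  \<open>c / G\<close> is the coefficient of the projection of \<open>f\<close> on \<open>g\<close>.
  If \<open>G = 0\<close>, there is no such coefficient, but \<open>g\<close> vanishes almost
  everywhere.\<close>

lemma Cauchy_Schwarz_integral:
  fixes f g :: "'a \<Rightarrow> real"
  assumes [measurable]: "f \<in> borel_measurable M" "g \<in> borel_measurable M"
    and f: "integrable M (\<lambda>x. (f x)\<^sup>2)" and g: "integrable M (\<lambda>x. (g x)\<^sup>2)"
  shows "\<bar>LINT x|M. f x * g x\<bar> \<le> sqrt (LINT x|M. (f x)\<^sup>2) * sqrt (LINT x|M. (g x)\<^sup>2)"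
proof -
  define F G c where "F = (LINT x|M. (f x)\<^sup>2)" and "G = (LINT x|M. (g x)\<^sup>2)"
    and "c = (LINT x|M. f x * g x)"
  note fg = integrable_mult_L2[OF assms]
  have "c\<^sup>2 \<le> F * G"
  proof (cases "G = 0")
    case True
    then have "AE x in M. (g x)\<^sup>2 = 0"
      using integral_nonneg_eq_0_iff_AE[OF g] by (simp add: G_def)
    then have "c = (LINT x|M. 0)"
      unfolding c_def by (intro integral_cong_AE) auto
    then show ?thesis using True by simp
  next
    case False
    then have G: "0 < G" by (simp add: G_def order_less_le)
    have "0 \<le> (LINT x|M. (f x - c / G * g x)\<^sup>2)" by simp
    also have "(\<lambda>x. (f x - c / G * g x)\<^sup>2) =
        (\<lambda>x. (f x)\<^sup>2 - 2 * (c / G) * (f x * g x) + (c / G)\<^sup>2 * (g x)\<^sup>2)"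
      by (auto simp: power2_eq_square algebra_simps)
    also have "(LINT x|M. (f x)\<^sup>2 - 2 * (c / G) * (f x * g x) + (c / G)\<^sup>2 * (g x)\<^sup>2)
        = F - 2 * (c / G) * c + (c / G)\<^sup>2 * G"
      unfolding F_def G_def c_def using f g fg by simp
    also have "\<dots> = F - c\<^sup>2 / G" using G by (simp add: power2_eq_square field_simps)
    finally show ?thesis using G by (simp add: field_simps)
  qed
  then have "sqrt (c\<^sup>2) \<le> sqrt (F * G)" by (rule real_sqrt_le_mono)
  then show ?thesis by (simp add: real_sqrt_mult F_def G_def c_def)
qed

text \<open>The cross term pairs \<open>g\<close> with the difference, so that after integration
  Cauchy-Schwarz bounds it by the norm of \<open>g\<close> times the distance between
  \<open>f\<close> and \<open>g\<close>.\<close>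

lemma abs_power2_diff_le:
  fixes f g :: real
  shows "\<bar>f\<^sup>2 - g\<^sup>2\<bar> \<le> (f - g)\<^sup>2 + 2 * (\<bar>g\<bar> * \<bar>f - g\<bar>)"
proof -
  have "f\<^sup>2 - g\<^sup>2 = (f - g)\<^sup>2 + 2 * (g * (f - g))" by (simp add: power2_eq_square algebra_simps)
  then show ?thesis using abs_triangle_ineq[of "(f - g)\<^sup>2" "2 * (g * (f - g))"] by (simp add: abs_mult)
qed

text \<open>Norms and inner products are continuous in L2: Cauchy-Schwarz leaves a factor
  \<open>sqrt (e n)\<close> in every error term. Square integrability is required only eventually
  because local parameters enter the parameter set only for large \<open>n\<close>.\<close>

lemma L2_tendsto:
  fixes f :: "nat \<Rightarrow> 'a \<Rightarrow> real"
  assumes ev: "\<forall>\<^sub>F n in sequentially. f n \<in> borel_measurable M \<and> integrable M (\<lambda>x. (f n x)\<^sup>2)"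
    and [measurable]: "g \<in> borel_measurable M" and g: "integrable M (\<lambda>x. (g x)\<^sup>2)"
    and lim: "(\<lambda>n. LINT x|M. (f n x - g x)\<^sup>2) \<longlonglongrightarrow> 0"
  shows L2_tendsto_norm: "(\<lambda>n. LINT x|M. (f n x)\<^sup>2) \<longlonglongrightarrow> (LINT x|M. (g x)\<^sup>2)"
    and L2_tendsto_inner: "\<lbrakk>k \<in> borel_measurable M; integrable M (\<lambda>x. (k x)\<^sup>2)\<rbrakk> \<Longrightarrow>
      (\<lambda>n. LINT x|M. f n x * k x) \<longlonglongrightarrow> (LINT x|M. g x * k x)"
proof -
  define e where "e n = (LINT x|M. (f n x - g x)\<^sup>2)" for n
  have e: "e \<longlonglongrightarrow> 0" using lim by (simp add: e_def[abs_def])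
  have "(\<lambda>n. (LINT x|M. (f n x)\<^sup>2) - (LINT x|M. (g x)\<^sup>2)) \<longlonglongrightarrow> 0"
  proof (rule Lim_null_comparison)
    show "(\<lambda>n. e n + 2 * (sqrt (LINT x|M. (g x)\<^sup>2) * sqrt (e n))) \<longlonglongrightarrow> 0"
      using e by (auto intro!: tendsto_eq_intros)
    show "\<forall>\<^sub>F n in sequentially. norm ((LINT x|M. (f n x)\<^sup>2) - (LINT x|M. (g x)\<^sup>2))
        \<le> e n + 2 * (sqrt (LINT x|M. (g x)\<^sup>2) * sqrt (e n))"
      using ev
    proof eventually_elim
      case (elim n)
      then have [measurable]: "f n \<in> borel_measurable M" and f: "integrable M (\<lambda>x. (f n x)\<^sup>2)" by auto
      have d: "integrable M (\<lambda>x. (f n x - g x)\<^sup>2)"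
        by (rule integrable_add_L2) (use f g in auto)
      have gd: "integrable M (\<lambda>x. \<bar>g x\<bar> * \<bar>f n x - g x\<bar>)"
        by (rule integrable_mult_L2) (use g d in auto)
      have "\<bar>(LINT x|M. (f n x)\<^sup>2) - (LINT x|M. (g x)\<^sup>2)\<bar> = \<bar>LINT x|M. (f n x)\<^sup>2 - (g x)\<^sup>2\<bar>"
        using f g by simp
      also have "\<dots> \<le> (LINT x|M. \<bar>(f n x)\<^sup>2 - (g x)\<^sup>2\<bar>)" by (rule integral_abs_bound)
      also have "\<dots> \<le> (LINT x|M. (f n x - g x)\<^sup>2 + 2 * (\<bar>g x\<bar> * \<bar>f n x - g x\<bar>))"
        using f g d gd by (intro integral_mono abs_power2_diff_le) auto
      also have "\<dots> = e n + 2 * (LINT x|M. \<bar>g x\<bar> * \<bar>f n x - g x\<bar>)"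
        using d gd by (simp add: e_def)
      also have "(LINT x|M. \<bar>g x\<bar> * \<bar>f n x - g x\<bar>) \<le> sqrt (LINT x|M. (g x)\<^sup>2) * sqrt (e n)"
        using Cauchy_Schwarz_integral[of "\<lambda>x. \<bar>g x\<bar>" M "\<lambda>x. \<bar>f n x - g x\<bar>"] g d by (simp add: e_def)
      finally show ?case by simp
    qed
  qed
  then show "(\<lambda>n. LINT x|M. (f n x)\<^sup>2) \<longlonglongrightarrow> (LINT x|M. (g x)\<^sup>2)" using Lim_null by blast
  assume [measurable]: "k \<in> borel_measurable M" and k: "integrable M (\<lambda>x. (k x)\<^sup>2)"
  have "(\<lambda>n. (LINT x|M. f n x * k x) - (LINT x|M. g x * k x)) \<longlonglongrightarrow> 0"
  proof (rule Lim_null_comparison)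
    show "(\<lambda>n. sqrt (e n) * sqrt (LINT x|M. (k x)\<^sup>2)) \<longlonglongrightarrow> 0"
      using e by (auto intro!: tendsto_eq_intros)
    show "\<forall>\<^sub>F n in sequentially. norm ((LINT x|M. f n x * k x) - (LINT x|M. g x * k x))
        \<le> sqrt (e n) * sqrt (LINT x|M. (k x)\<^sup>2)"
      using ev
    proof eventually_elim
      case (elim n)
      then have [measurable]: "f n \<in> borel_measurable M" and f: "integrable M (\<lambda>x. (f n x)\<^sup>2)" by auto
      have d: "integrable M (\<lambda>x. (f n x - g x)\<^sup>2)"
        by (rule integrable_add_L2) (use f g in auto)
      have "integrable M (\<lambda>x. f n x * k x)" "integrable M (\<lambda>x. g x * k x)"
        using f g k by (auto intro: integrable_mult_L2)
      then have "(LINT x|M. f n x * k x) - (LINT x|M. g x * k x) = (LINT x|M. (f n x - g x) * k x)"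
        by (simp add: left_diff_distrib)
      then show ?case
        using Cauchy_Schwarz_integral[of "\<lambda>x. f n x - g x" M k] d k by (simp add: e_def)
    qed
  qed
  then show "(\<lambda>n. LINT x|M. f n x * k x) \<longlonglongrightarrow> (LINT x|M. g x * k x)" using Lim_null by blast
qed

subsection \<open>Expansion of the logarithm\<close>

text \<open>The remainder vanishes at 0 and has derivative \<open>y\<^sup>2 / (1 + y)\<close>.
  Between 0 and \<open>x\<close> the denominator is at least 1/2, which is the source of the
  constant 2 in the mean value inequality.\<close>

lemma abs_ln_one_plus_third_order_bound:
  fixes x :: real
  assumes "\<bar>x\<bar> \<le> 1/2"
  shows "\<bar>ln (1 + x) - x + x\<^sup>2 / 2\<bar> \<le> 2 * \<bar>x\<bar> ^ 3"
proof -
  have D: "((\<lambda>x. ln (1 + x) - x + x\<^sup>2 / 2) has_field_derivative y\<^sup>2 / (1 + y)) (at y within {-(1/2)..1/2})"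
    if "y \<in> {-(1/2)..1/2}" for y :: real
    using that by (auto intro!: derivative_eq_intros simp: field_simps power2_eq_square)
  let ?S = "{- \<bar>x\<bar>..\<bar>x\<bar>}"
  have "norm ((ln (1 + x) - x + x\<^sup>2 / 2) - (ln (1 + 0) - 0 + 0\<^sup>2 / 2)) \<le> (2 * \<bar>x\<bar>\<^sup>2) * norm (x - 0)"
  proof (rule field_differentiable_bound[where S = ?S and f' = "\<lambda>y. y\<^sup>2 / (1 + y)"])
    fix y assume y: "y \<in> ?S"
    show "((\<lambda>x. ln (1 + x) - x + x\<^sup>2 / 2) has_field_derivative y\<^sup>2 / (1 + y)) (at y within ?S)"
      by (rule has_field_derivative_subset[OF D]) (use y assms in auto)
    have "y\<^sup>2 \<le> \<bar>x\<bar>\<^sup>2" using y by (intro abs_le_square_iff[THEN iffD1]) auto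
    moreover have "1/2 \<le> 1 + y" using y assms by auto
    ultimately have "y\<^sup>2 / (1 + y) \<le> \<bar>x\<bar>\<^sup>2 / (1/2)" by (intro frac_le) auto
    then show "norm (y\<^sup>2 / (1 + y)) \<le> 2 * \<bar>x\<bar>\<^sup>2" using \<open>1/2 \<le> 1 + y\<close> by simp
  qed auto
  then show ?thesis by (simp add: power2_eq_square power3_eq_cube mult.assoc)
qed

text \<open>
  The quantity \<open>w\<^sup>2 min(1, \<bar>w\<bar>)\<close> plays two roles: it dominates the cubic Taylor remainder where \<open>\<bar>w\<bar> \<le> 1\<close>,
  and it is at least 1 elsewhere, so that a small sum excludes large \<open>w\<close>.
\<close>

lemma sum_ln_expansion:
  fixes w :: "nat \<Rightarrow> real"
  assumes Z: "(\<Sum>i<n. (w i)\<^sup>2 * min 1 \<bar>w i\<bar>) < 1"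
  shows "\<And>i. i < n \<Longrightarrow> \<bar>w i\<bar> \<le> 1"
    and "\<bar>(\<Sum>i<n. 2 * ln (1 + w i / 2)) - (\<Sum>i<n. w i) + (\<Sum>i<n. (w i)\<^sup>2) / 4\<bar>
      \<le> (\<Sum>i<n. (w i)\<^sup>2 * min 1 \<bar>w i\<bar>)"
proof -
  show w: "\<bar>w i\<bar> \<le> 1" if "i < n" for i
  proof (rule ccontr)
    assume w: "\<not> \<bar>w i\<bar> \<le> 1"
    then have "1 \<le> \<bar>w i\<bar> ^ 2" by (intro one_le_power) auto
    with w have "1 \<le> (w i)\<^sup>2 * min 1 \<bar>w i\<bar>" by simp
    also have "\<dots> \<le> (\<Sum>i<n. (w i)\<^sup>2 * min 1 \<bar>w i\<bar>)"
      by (rule member_le_sum) (use that in auto)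
    finally show False using Z by simp
  qed
  have "\<bar>2 * ln (1 + w i / 2) - w i + (w i)\<^sup>2 / 4\<bar> \<le> (w i)\<^sup>2 * min 1 \<bar>w i\<bar>" if "i < n" for i
  proof -
    have "\<bar>2 * ln (1 + w i / 2) - w i + (w i)\<^sup>2 / 4\<bar> = 2 * \<bar>ln (1 + w i / 2) - w i / 2 + (w i / 2)\<^sup>2 / 2\<bar>"
      by (simp add: abs_if power2_eq_square)
    also have "\<dots> \<le> 2 * (2 * \<bar>w i / 2\<bar> ^ 3)"
      by (intro mult_left_mono abs_ln_one_plus_third_order_bound) (use w[OF that] in auto)
    \<comment> \<open>The left side is half of the right side; the factor 1/2 is given away so that
      the sum in the hypothesis can itself serve as the error bound.\<close>
    also have "\<dots> \<le> \<bar>w i\<bar> ^ 3" by (simp add: power_abs power_divide flip: power_abs)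
    also have "\<dots> = (w i)\<^sup>2 * min 1 \<bar>w i\<bar>" using w[OF that] by (simp add: power3_eq_cube power2_eq_square)
    finally show ?thesis .
  qed
  then have "(\<Sum>i<n. \<bar>2 * ln (1 + w i / 2) - w i + (w i)\<^sup>2 / 4\<bar>) \<le> (\<Sum>i<n. (w i)\<^sup>2 * min 1 \<bar>w i\<bar>)"
    by (intro sum_mono) auto
  then show "\<bar>(\<Sum>i<n. 2 * ln (1 + w i / 2)) - (\<Sum>i<n. w i) + (\<Sum>i<n. (w i)\<^sup>2) / 4\<bar>
      \<le> (\<Sum>i<n. (w i)\<^sup>2 * min 1 \<bar>w i\<bar>)"
    using sum_abs[of "\<lambda>i. 2 * ln (1 + w i / 2) - w i + (w i)\<^sup>2 / 4" "{..<n}"]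
    by (simp add: sum.distrib sum_subtractf sum_divide_distrib)
qed

subsection \<open>Sums over independent samples\<close>

context prob_space begin

lemma prob_space_iid: "prob_space (Pi\<^sub>M I (\<lambda>_::nat. M))"
  by (intro prob_space_PiM prob_space_axioms)

lemma iid_component:
  fixes f :: "'a \<Rightarrow> real" and n :: nat
  assumes "i < n" "integrable M f"
  shows "integrable (Pi\<^sub>M {..<n} (\<lambda>_. M)) (\<lambda>\<omega>. f (\<omega> i))"
    and "(LINT \<omega>|Pi\<^sub>M {..<n} (\<lambda>_. M). f (\<omega> i)) = expectation f"
proof -
  have d: "distr (Pi\<^sub>M {..<n} (\<lambda>_. M)) M (\<lambda>\<omega>. \<omega> i) = M"
    using assms by (intro distr_PiM_component prob_space_axioms) auto
  have [measurable]: "(\<lambda>\<omega>. \<omega> i) \<in> measurable (Pi\<^sub>M {..<n} (\<lambda>_. M)) M"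
    using assms by (intro measurable_component_singleton) auto
  have [measurable]: "f \<in> borel_measurable M" using assms by auto
  show "integrable (Pi\<^sub>M {..<n} (\<lambda>_. M)) (\<lambda>\<omega>. f (\<omega> i))"
    using integrable_distr_eq[of "\<lambda>\<omega>. \<omega> i" "Pi\<^sub>M {..<n} (\<lambda>_. M)" M f] assms by (simp add: d)
  show "(LINT \<omega>|Pi\<^sub>M {..<n} (\<lambda>_. M). f (\<omega> i)) = expectation f"
    using integral_distr[of "\<lambda>\<omega>. \<omega> i" "Pi\<^sub>M {..<n} (\<lambda>_. M)" M f] by (simp add: d)
qed

lemma iid_sum:
  fixes f :: "'a \<Rightarrow> real" and n :: nat
  assumes "integrable M f"
  shows "integrable (Pi\<^sub>M {..<n} (\<lambda>_. M)) (\<lambda>\<omega>. \<Sum>i<n. f (\<omega> i))"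
    and "(LINT \<omega>|Pi\<^sub>M {..<n} (\<lambda>_. M). (\<Sum>i<n. f (\<omega> i))) = n * expectation f"
proof -
  show "integrable (Pi\<^sub>M {..<n} (\<lambda>_. M)) (\<lambda>\<omega>. \<Sum>i<n. f (\<omega> i))"
    using iid_component(1)[OF _ assms] by (intro Bochner_Integration.integrable_sum) auto
  have "(LINT \<omega>|Pi\<^sub>M {..<n} (\<lambda>_. M). (\<Sum>i<n. f (\<omega> i)))
      = (\<Sum>i<n. LINT \<omega>|Pi\<^sub>M {..<n} (\<lambda>_. M). f (\<omega> i))"
    by (rule Bochner_Integration.integral_sum) (use iid_component(1)[OF _ assms] in auto)
  also have "\<dots> = n * expectation f" using iid_component(2)[OF _ assms] by simp
  finally show "(LINT \<omega>|Pi\<^sub>M {..<n} (\<lambda>_. M). (\<Sum>i<n. f (\<omega> i))) = n * expectation f" .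
qed

text \<open>Fubini for a product over all coordinates in which every factor except those at
  \<open>i\<close> and \<open>j\<close> is the constant 1, with integral 1.\<close>

lemma iid_pair:
  fixes f g :: "'a \<Rightarrow> real" and n :: nat
  assumes ij: "i < n" "j < n" "i \<noteq> j" and f: "integrable M f" and g: "integrable M g"
  shows "integrable (Pi\<^sub>M {..<n} (\<lambda>_. M)) (\<lambda>\<omega>. f (\<omega> i) * g (\<omega> j))"
    and "(LINT \<omega>|Pi\<^sub>M {..<n} (\<lambda>_. M). f (\<omega> i) * g (\<omega> j)) = expectation f * expectation g"
proof -
  interpret I: product_sigma_finite "\<lambda>_::nat. M"
    by (simp add: product_sigma_finite_def sigma_finite_measure_axioms)
  \<comment> \<open>Writing the factor as a product of two conditionals, rather than nesting them,
    lets the product over \<open>k\<close> split into two products with a single nontrivial factor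
    each.\<close>
  define F where "F k x = (if k = i then f x else 1) * (if k = j then g x else 1)" for k x
  have F: "integrable M (F k)" for k using f g ij by (cases "k = i"; cases "k = j") (auto simp: F_def[abs_def])
  have eq: "(\<Prod>k<n. F k (\<omega> k)) = f (\<omega> i) * g (\<omega> j)" for \<omega>
  proof -
    have "F k (\<omega> k) = (if k = i then f (\<omega> i) else 1) * (if k = j then g (\<omega> j) else 1)" for k
      by (simp add: F_def)
    then show ?thesis using ij by (simp add: prod.distrib)
  qed
  have "expectation (F k) = (if k = i then expectation f else 1) * (if k = j then expectation g else 1)" for k
    using ij by (auto simp: F_def[abs_def] prob_space cong: if_cong)
  then have eq': "(\<Prod>k<n. expectation (F k)) = expectation f * expectation g"
    using ij by (simp add: prod.distrib)
  show "integrable (Pi\<^sub>M {..<n} (\<lambda>_. M)) (\<lambda>\<omega>. f (\<omega> i) * g (\<omega> j))"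
    using I.product_integrable_prod[of "{..<n}" F] F by (simp add: eq)
  show "(LINT \<omega>|Pi\<^sub>M {..<n} (\<lambda>_. M). f (\<omega> i) * g (\<omega> j)) = expectation f * expectation g"
    using I.product_integral_prod[of "{..<n}" F] F by (simp add: eq eq')
qed

text \<open>In the double sum the off-diagonal terms factor by independence and vanish since
  \<open>f\<close> is centred; the \<open>n\<close> diagonal terms remain. Taking
  \<open>g = f\<close> gives the variance of a sum, and distinct functions give the mixed moments of
  the score.\<close>

lemma iid_sum_mult:
  fixes f g :: "'a \<Rightarrow> real" and n :: nat
  assumes [measurable]: "f \<in> borel_measurable M" "g \<in> borel_measurable M"
    and f: "integrable M (\<lambda>x. (f x)\<^sup>2)" and g: "integrable M (\<lambda>x. (g x)\<^sup>2)"
    and f0: "expectation f = 0"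
  shows "integrable (Pi\<^sub>M {..<n} (\<lambda>_. M)) (\<lambda>\<omega>. (\<Sum>i<n. f (\<omega> i)) * (\<Sum>i<n. g (\<omega> i)))"
    and "(LINT \<omega>|Pi\<^sub>M {..<n} (\<lambda>_. M). (\<Sum>i<n. f (\<omega> i)) * (\<Sum>i<n. g (\<omega> i)))
      = n * expectation (\<lambda>x. f x * g x)"
proof -
  have f1: "integrable M f" and g1: "integrable M g"
    using square_integrable_imp_integrable[OF _ f] square_integrable_imp_integrable[OF _ g] by auto
  have fg: "integrable M (\<lambda>x. f x * g x)" using f g by (intro integrable_mult_L2) auto
  have I: "integrable (Pi\<^sub>M {..<n} (\<lambda>_. M)) (\<lambda>\<omega>. f (\<omega> i) * g (\<omega> j))"
    and E: "(LINT \<omega>|Pi\<^sub>M {..<n} (\<lambda>_. M). f (\<omega> i) * g (\<omega> j))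
       = (if i = j then expectation (\<lambda>x. f x * g x) else 0)" if "i < n" "j < n" for i j
    using iid_component[OF _ fg, of i n] iid_pair[OF that _ f1 g1] that f0 by (cases "i = j"; simp)+
  have eq: "(\<Sum>i<n. f (\<omega> i)) * (\<Sum>i<n. g (\<omega> i)) = (\<Sum>i<n. \<Sum>j<n. f (\<omega> i) * g (\<omega> j))" for \<omega>
    by (rule sum_product)
  show "integrable (Pi\<^sub>M {..<n} (\<lambda>_. M)) (\<lambda>\<omega>. (\<Sum>i<n. f (\<omega> i)) * (\<Sum>i<n. g (\<omega> i)))"
    unfolding eq using I by (intro Bochner_Integration.integrable_sum) auto
  have "(LINT \<omega>|Pi\<^sub>M {..<n} (\<lambda>_. M). (\<Sum>i<n. \<Sum>j<n. f (\<omega> i) * g (\<omega> j)))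
      = (\<Sum>i<n. \<Sum>j<n. LINT \<omega>|Pi\<^sub>M {..<n} (\<lambda>_. M). f (\<omega> i) * g (\<omega> j))"
    using I by (subst Bochner_Integration.integral_sum;
        (intro sum.cong refl Bochner_Integration.integral_sum Bochner_Integration.integrable_sum)?) auto
  also have "\<dots> = n * expectation (\<lambda>x. f x * g x)" by (simp add: E)
  finally show "(LINT \<omega>|Pi\<^sub>M {..<n} (\<lambda>_. M). (\<Sum>i<n. f (\<omega> i)) * (\<Sum>i<n. g (\<omega> i)))
      = n * expectation (\<lambda>x. f x * g x)" unfolding eq .
qed

lemma expectation_abs_le_sqrt:
  fixes f :: "'a \<Rightarrow> real"
  assumes "f \<in> borel_measurable M" "integrable M (\<lambda>x. (f x)\<^sup>2)"
  shows "expectation (\<lambda>x. \<bar>f x\<bar>) \<le> sqrt (expectation (\<lambda>x. (f x)\<^sup>2))"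
  using Cauchy_Schwarz_integral[of "\<lambda>x. \<bar>f x\<bar>" M "\<lambda>_. 1"] assms by (simp add: prob_space)

text \<open>The L1 norm is at most the L2 norm, and the variance of the centred sum is
  \<open>n\<close> times the variance of \<open>f\<close>. The variance is then enlarged to the raw
  second moment, the quantity for which estimates are at hand later.\<close>

lemma iid_sum_abs_deviation:
  fixes f :: "'a \<Rightarrow> real" and n :: nat
  assumes [measurable]: "f \<in> borel_measurable M" and f: "integrable M (\<lambda>x. (f x)\<^sup>2)"
  shows "(LINT \<omega>|Pi\<^sub>M {..<n} (\<lambda>_. M). \<bar>(\<Sum>i<n. f (\<omega> i)) - n * expectation f\<bar>)
    \<le> sqrt (n * expectation (\<lambda>x. (f x)\<^sup>2))"
proof -
  interpret P: prob_space "Pi\<^sub>M {..<n} (\<lambda>_. M)" by (rule prob_space_iid)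
  have f1: "integrable M f" using square_integrable_imp_integrable[OF _ f] by auto
  define h where "h x = f x - expectation f" for x
  have [measurable]: "h \<in> borel_measurable M" unfolding h_def by simp
  have h2: "integrable M (\<lambda>x. (h x)\<^sup>2)" unfolding h_def using f by (intro integrable_add_L2) auto
  have h0: "expectation h = 0" unfolding h_def using f1 by (simp add: prob_space)
  have "expectation (\<lambda>x. (h x)\<^sup>2) = expectation (\<lambda>x. (f x)\<^sup>2) - (expectation f)\<^sup>2"
    unfolding h_def using variance_eq[OF f1] f by simp
  then have le: "expectation (\<lambda>x. (h x)\<^sup>2) \<le> expectation (\<lambda>x. (f x)\<^sup>2)" by simp
  have eq: "(\<Sum>i<n. f (\<omega> i)) - n * expectation f = (\<Sum>i<n. h (\<omega> i))" for \<omega>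
    by (simp add: h_def sum_subtractf)
  note m = iid_sum_mult[of h h, OF _ _ h2 h2 h0, of n, folded power2_eq_square]
  have "(LINT \<omega>|Pi\<^sub>M {..<n} (\<lambda>_. M). \<bar>\<Sum>i<n. h (\<omega> i)\<bar>)
     \<le> sqrt (LINT \<omega>|Pi\<^sub>M {..<n} (\<lambda>_. M). (\<Sum>i<n. h (\<omega> i))\<^sup>2)"
    by (rule P.expectation_abs_le_sqrt) (use m in auto)
  also have "\<dots> \<le> sqrt (n * expectation (\<lambda>x. (f x)\<^sup>2))"
    using m le by (auto intro!: real_sqrt_le_mono mult_left_mono)
  finally show ?thesis unfolding eq .
qed

section \<open>Truncation and the error of the logarithmic expansion\<close>

text \<open>A Lindeberg-type quantity: with \<open>u = s / sqrt n\<close> it equals \<open>n\<close>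
  times the mean of \<open>u\<^sup>2 * min 1 \<bar>u\<bar>\<close>. The integrand tends to 0
  pointwise and is dominated by \<open>(s x)\<^sup>2\<close>.\<close>

lemma truncated_second_moment_tendsto_0:
  fixes s :: "'a \<Rightarrow> real"
  assumes [measurable]: "s \<in> borel_measurable M" and s: "integrable M (\<lambda>x. (s x)\<^sup>2)"
  shows "(\<lambda>n. expectation (\<lambda>x. (s x)\<^sup>2 * min 1 \<bar>s x / sqrt (real n)\<bar>)) \<longlonglongrightarrow> 0"
proof -
  have "(\<lambda>n. expectation (\<lambda>x. (s x)\<^sup>2 * min 1 \<bar>s x / sqrt (real n)\<bar>)) \<longlonglongrightarrow> expectation (\<lambda>x. 0)"
  proof (rule integral_dominated_convergence[where w = "\<lambda>x. (s x)\<^sup>2"])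
    show "AE x in M. (\<lambda>n. (s x)\<^sup>2 * min 1 \<bar>s x / sqrt (real n)\<bar>) \<longlonglongrightarrow> 0"
    proof (rule AE_I2)
      fix x
      have "(\<lambda>n. s x / sqrt (real n)) \<longlonglongrightarrow> 0" by real_asymp
      then have "(\<lambda>n. (s x)\<^sup>2 * min 1 \<bar>s x / sqrt (real n)\<bar>) \<longlonglongrightarrow> (s x)\<^sup>2 * min 1 \<bar>0\<bar>"
        by (intro tendsto_intros)
      then show "(\<lambda>n. (s x)\<^sup>2 * min 1 \<bar>s x / sqrt (real n)\<bar>) \<longlonglongrightarrow> 0" by simp
    qed
    show "AE x in M. norm ((s x)\<^sup>2 * min 1 \<bar>s x / sqrt (real n)\<bar>) \<le> (s x)\<^sup>2" for n
      by (rule AE_I2) (simp add: abs_mult mult_left_le)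
  qed (use s in auto)
  then show ?thesis by simp
qed

text \<open>All bounds are in terms of the Lindeberg quantity of \<open>u\<close>. The first
  controls the bias of truncating the squares, the second the variance of the truncated squares, and
  the third carries smallness of the capped cube over from \<open>u\<close> to a nearby
  \<open>w\<close>.\<close>

lemma truncation_bounds:
  fixes u w :: real
  shows "u\<^sup>2 - (if \<bar>u\<bar> \<le> 1 then u\<^sup>2 else 0) \<le> u\<^sup>2 * min 1 \<bar>u\<bar>"
    and "(if \<bar>u\<bar> \<le> 1 then u\<^sup>2 else 0)\<^sup>2 \<le> u\<^sup>2 * min 1 \<bar>u\<bar>"
    and "w\<^sup>2 * min 1 \<bar>w\<bar> \<le> 2 * (w - u)\<^sup>2 + 4 * (u\<^sup>2 * min 1 \<bar>u\<bar>) + 2 * (\<bar>u\<bar> * \<bar>w - u\<bar>)"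
proof -
  show "u\<^sup>2 - (if \<bar>u\<bar> \<le> 1 then u\<^sup>2 else 0) \<le> u\<^sup>2 * min 1 \<bar>u\<bar>" by auto
  have "u\<^sup>2 * u\<^sup>2 \<le> u\<^sup>2 * \<bar>u\<bar>" if "\<bar>u\<bar> \<le> 1"
    using that mult_left_le[of "\<bar>u\<bar>" "\<bar>u\<bar>"] by (intro mult_left_mono) (auto simp: power2_eq_square simp flip: abs_mult)
  then show "(if \<bar>u\<bar> \<le> 1 then u\<^sup>2 else 0)\<^sup>2 \<le> u\<^sup>2 * min 1 \<bar>u\<bar>"
    by (auto simp: power2_eq_square[of "u\<^sup>2"])
  define d where "d = w - u"
  have w: "w = u + d" by (simp add: d_def)
  have "0 \<le> (u - d)\<^sup>2" by simp
  then have "w\<^sup>2 \<le> 2 * u\<^sup>2 + 2 * d\<^sup>2" unfolding w power2_sum power2_diff by linarith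
  then have 1: "w\<^sup>2 * min 1 \<bar>w\<bar> \<le> (2 * u\<^sup>2 + 2 * d\<^sup>2) * min 1 \<bar>w\<bar>" by (intro mult_right_mono) auto
  have 2: "d\<^sup>2 * min 1 \<bar>w\<bar> \<le> d\<^sup>2" by (intro mult_left_le) auto
  \<comment> \<open>The function \<open>min 1 \<bar>x\<bar>\<close> is subadditive.\<close>
  have "u\<^sup>2 * min 1 \<bar>w\<bar> \<le> u\<^sup>2 * (min 1 \<bar>u\<bar> + min 1 \<bar>d\<bar>)"
    unfolding w by (intro mult_left_mono) auto
  \<comment> \<open>The aim is the product \<open>\<bar>u\<bar> * \<bar>d\<bar>\<close>, which
    Cauchy-Schwarz can handle. For \<open>\<bar>u\<bar> \<le> 1\<close> one power of
    \<open>u\<close> is dropped; for larger \<open>u\<close> the cap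
    \<open>min 1 \<bar>u\<bar>\<close> is already 1 and the first term absorbs everything.\<close>
  also have "u\<^sup>2 * min 1 \<bar>d\<bar> \<le> u\<^sup>2 * min 1 \<bar>u\<bar> + \<bar>u\<bar> * \<bar>d\<bar>"
  proof (cases "\<bar>u\<bar> \<le> 1")
    case True
    then have "\<bar>u\<bar> * \<bar>u\<bar> \<le> \<bar>u\<bar>" by (intro mult_left_le) auto
    then have "u\<^sup>2 * min 1 \<bar>d\<bar> \<le> \<bar>u\<bar> * \<bar>d\<bar>" by (intro mult_mono) (auto simp: power2_eq_square)
    then show ?thesis by (simp add: add_increasing)
  next
    case False
    then have "u\<^sup>2 * min 1 \<bar>d\<bar> \<le> u\<^sup>2 * min 1 \<bar>u\<bar>" by (intro mult_left_mono) auto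
    then show ?thesis by (simp add: add_increasing2)
  qed
  then have "u\<^sup>2 * (min 1 \<bar>u\<bar> + min 1 \<bar>d\<bar>) \<le> 2 * (u\<^sup>2 * min 1 \<bar>u\<bar>) + \<bar>u\<bar> * \<bar>d\<bar>"
    unfolding distrib_left by linarith
  finally have 3: "u\<^sup>2 * min 1 \<bar>w\<bar> \<le> 2 * (u\<^sup>2 * min 1 \<bar>u\<bar>) + \<bar>u\<bar> * \<bar>d\<bar>" .
  show "w\<^sup>2 * min 1 \<bar>w\<bar> \<le> 2 * (w - u)\<^sup>2 + 4 * (u\<^sup>2 * min 1 \<bar>u\<bar>) + 2 * (\<bar>u\<bar> * \<bar>w - u\<bar>)"
    using 1 2 3 unfolding d_def[symmetric] distrib_right by linarith
qed

text \<open>A bound for fixed \<open>n\<close> in terms of two small numbers: \<open>d\<close>, the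
  L2 discrepancy of \<open>w\<close> and \<open>u\<close>, and \<open>V\<close>, the Lindeberg
  quantity of \<open>u\<close>. The summands of \<open>T\<close> are the errors of the linear part,
  of the squares, weighted by the Taylor coefficient 1/4, and of the remainder.\<close>

lemma iid_log_expansion_error:
  fixes u w :: "'a \<Rightarrow> real" and \<sigma>2 :: real and n :: nat
  defines "P \<equiv> Pi\<^sub>M {..<n} (\<lambda>_. M)"
  defines "d \<equiv> n * expectation (\<lambda>x. (w x - u x)\<^sup>2)"
    and "V \<equiv> n * expectation (\<lambda>x. (u x)\<^sup>2 * min 1 \<bar>u x\<bar>)"
    and "T \<equiv> \<lambda>\<omega>. \<bar>(\<Sum>i<n. w (\<omega> i) - u (\<omega> i)) + \<sigma>2 / 4\<bar> + \<bar>(\<Sum>i<n. (w (\<omega> i))\<^sup>2) - \<sigma>2\<bar> / 4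
      + (\<Sum>i<n. (w (\<omega> i))\<^sup>2 * min 1 \<bar>w (\<omega> i)\<bar>)"
  assumes [measurable]: "u \<in> borel_measurable M" "w \<in> borel_measurable M"
    and u: "integrable M (\<lambda>x. (u x)\<^sup>2)" and w: "integrable M (\<lambda>x. (w x)\<^sup>2)"
    and u0: "expectation u = 0" and \<sigma>2: "n * expectation (\<lambda>x. (u x)\<^sup>2) = \<sigma>2"
  shows "integrable P T"
    and "(LINT \<omega>|P. T \<omega>) \<le> sqrt d + \<bar>n * expectation w + \<sigma>2 / 4\<bar>
      + (d + 2 * sqrt (\<sigma>2 * d) + 2 * V + sqrt V) / 4 + (2 * d + 4 * V + 2 * sqrt (\<sigma>2 * d))"
proof -
  interpret P: prob_space P unfolding P_def by (rule prob_space_iid)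
  note iid_sum_P = iid_sum[of _ n, folded P_def]
  \<comment> \<open>\<open>Y\<close> is the truncated square. Its second moment is at most that of
    the Lindeberg integrand \<open>v\<close>, so the weak law for \<open>Y\<close> requires no
    fourth moment of \<open>u\<close>.\<close>
  define D Y v where "D x = w x - u x" and "Y x = (if \<bar>u x\<bar> \<le> 1 then (u x)\<^sup>2 else 0)"
    and "v x = (u x)\<^sup>2 * min 1 \<bar>u x\<bar>" for x
  have [measurable]: "D \<in> borel_measurable M" "Y \<in> borel_measurable M" "v \<in> borel_measurable M"
    unfolding D_def Y_def v_def by measurable
  have D2: "integrable M (\<lambda>x. (D x)\<^sup>2)" unfolding D_def by (rule integrable_add_L2) (use u w in auto)
  have uD: "integrable M (\<lambda>x. \<bar>u x\<bar> * \<bar>D x\<bar>)" by (rule integrable_mult_L2) (use u D2 in auto)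
  have v1: "integrable M v"
    by (rule Bochner_Integration.integrable_bound[OF u]) (auto simp: v_def abs_mult mult_left_le)
  have Y1: "integrable M Y"
    by (rule Bochner_Integration.integrable_bound[OF u]) (auto simp: Y_def)
  have Y2: "integrable M (\<lambda>x. (Y x)\<^sup>2)"
    by (rule Bochner_Integration.integrable_bound[OF v1])
      (use truncation_bounds(2) in \<open>auto simp: Y_def v_def abs_mult\<close>)
  have Z1: "integrable M (\<lambda>x. (w x)\<^sup>2 * min 1 \<bar>w x\<bar>)"
    by (rule Bochner_Integration.integrable_bound[OF w]) (auto simp: abs_mult mult_left_le)
  have D1: "integrable M D" and u1: "integrable M u" and w1: "integrable M w"
    using square_integrable_imp_integrable[OF _ D2] square_integrable_imp_integrable[OF _ u]
      square_integrable_imp_integrable[OF _ w] by auto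
  have wu1: "integrable M (\<lambda>x. \<bar>(w x)\<^sup>2 - (u x)\<^sup>2\<bar>)" using w u by simp
  have uY: "integrable M (\<lambda>x. (u x)\<^sup>2 - Y x)" using u Y1 by simp
  define T1 T2 T3 where "T1 \<omega> = \<bar>(\<Sum>i<n. D (\<omega> i)) + \<sigma>2 / 4\<bar>"
    and "T2 \<omega> = \<bar>(\<Sum>i<n. (w (\<omega> i))\<^sup>2) - \<sigma>2\<bar>"
    and "T3 \<omega> = (\<Sum>i<n. (w (\<omega> i))\<^sup>2 * min 1 \<bar>w (\<omega> i)\<bar>)" for \<omega>
  have T: "T = (\<lambda>\<omega>. T1 \<omega> + T2 \<omega> / 4 + T3 \<omega>)"
    by (simp add: T_def T1_def T2_def T3_def D_def fun_eq_iff)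
  have i1: "integrable P T1" and i2: "integrable P T2" and i3: "integrable P T3"
    unfolding T1_def T2_def T3_def using iid_sum_P(1)[OF D1] iid_sum_P(1)[OF w] iid_sum_P(1)[OF Z1] by auto
  then show "integrable P T" unfolding T by simp
  have d: "d = n * expectation (\<lambda>x. (D x)\<^sup>2)" by (simp add: d_def D_def)
  have V: "V = n * expectation v" by (simp add: V_def v_def[abs_def])
  have "n * expectation (\<lambda>x. \<bar>u x\<bar> * \<bar>D x\<bar>)
      \<le> n * (sqrt (expectation (\<lambda>x. (u x)\<^sup>2)) * sqrt (expectation (\<lambda>x. (D x)\<^sup>2)))"
    using Cauchy_Schwarz_integral[of "\<lambda>x. \<bar>u x\<bar>" M "\<lambda>x. \<bar>D x\<bar>"] u D2
    by (intro mult_left_mono) auto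
  also have "\<dots> = sqrt (\<sigma>2 * d)"
    by (simp add: \<sigma>2[symmetric] d real_sqrt_mult)
  finally have CS: "n * expectation (\<lambda>x. \<bar>u x\<bar> * \<bar>D x\<bar>) \<le> sqrt (\<sigma>2 * d)" .

  \<comment> \<open>Since \<open>u\<close> is centred, the sum of differences fluctuates around
    \<open>n * expectation w\<close>. The distance of this mean from \<open>- \<sigma>2 / 4\<close>
    is kept as a separate term, because smallness of \<open>d\<close> does not control it.\<close>
  have ED: "expectation D = expectation w" unfolding D_def using w1 u1 u0 by simp
  have "(LINT \<omega>|P. T1 \<omega>) \<le> (LINT \<omega>|P. \<bar>(\<Sum>i<n. D (\<omega> i)) - n * expectation D\<bar>
      + \<bar>n * expectation w + \<sigma>2 / 4\<bar>)"
    using i1 iid_sum_P(1)[OF D1] by (intro integral_mono) (auto simp: T1_def ED)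
  also have "\<dots> = (LINT \<omega>|P. \<bar>(\<Sum>i<n. D (\<omega> i)) - n * expectation D\<bar>) + \<bar>n * expectation w + \<sigma>2 / 4\<bar>"
    using iid_sum_P(1)[OF D1] by (simp add: P.prob_space)
  also have "(LINT \<omega>|P. \<bar>(\<Sum>i<n. D (\<omega> i)) - n * expectation D\<bar>) \<le> sqrt d"
    unfolding d P_def by (rule iid_sum_abs_deviation) (use D2 in auto)
  finally have b1: "(LINT \<omega>|P. T1 \<omega>) \<le> sqrt d + \<bar>n * expectation w + \<sigma>2 / 4\<bar>" by simp

  have "expectation (\<lambda>x. \<bar>(w x)\<^sup>2 - (u x)\<^sup>2\<bar>) \<le> expectation (\<lambda>x. (D x)\<^sup>2 + 2 * (\<bar>u x\<bar> * \<bar>D x\<bar>))"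
    unfolding D_def
    by (intro integral_mono abs_power2_diff_le) (use w u D2 uD in \<open>auto simp: D_def\<close>)
  also have "\<dots> = expectation (\<lambda>x. (D x)\<^sup>2) + 2 * expectation (\<lambda>x. \<bar>u x\<bar> * \<bar>D x\<bar>)"
    using D2 uD by simp
  finally have "n * expectation (\<lambda>x. \<bar>(w x)\<^sup>2 - (u x)\<^sup>2\<bar>) \<le> n * (expectation (\<lambda>x. (D x)\<^sup>2) + 2 * expectation (\<lambda>x. \<bar>u x\<bar> * \<bar>D x\<bar>))"
    by (intro mult_left_mono) auto
  also have "\<dots> \<le> d + 2 * sqrt (\<sigma>2 * d)" using CS by (simp add: distrib_left d)
  finally have b21: "n * expectation (\<lambda>x. \<bar>(w x)\<^sup>2 - (u x)\<^sup>2\<bar>) \<le> d + 2 * sqrt (\<sigma>2 * d)" .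
  have b22: "n * expectation (\<lambda>x. (u x)\<^sup>2 - Y x) \<le> V"
    unfolding V Y_def v_def by (intro mult_left_mono integral_mono truncation_bounds(1))
      (use uY v1 in \<open>auto simp: Y_def v_def[abs_def]\<close>)
  have "n * expectation (\<lambda>x. (Y x)\<^sup>2) \<le> V"
    unfolding V Y_def v_def by (intro mult_left_mono integral_mono truncation_bounds(2))
      (use Y2 v1 in \<open>auto simp: Y_def v_def[abs_def]\<close>)
  then have b23: "(LINT \<omega>|P. \<bar>(\<Sum>i<n. Y (\<omega> i)) - n * expectation Y\<bar>) \<le> sqrt V"
    using iid_sum_abs_deviation[of Y n, folded P_def] Y2
    by (auto intro: order_trans real_sqrt_le_mono)
  have EY: "n * expectation Y - \<sigma>2 = - (n * expectation (\<lambda>x. (u x)\<^sup>2 - Y x))"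
    using u Y1 by (simp add: \<sigma>2[symmetric] right_diff_distrib)
  have uYpos: "0 \<le> (u x)\<^sup>2 - Y x" for x by (simp add: Y_def)
  \<comment> \<open>The sum of the squares of \<open>w\<close> is compared in turn with that of
    \<open>u\<close>, with that of \<open>Y\<close>, with the mean of the latter, and with
    \<open>\<sigma>2\<close>. The four errors are due to the discrepancy, the truncation, the
    fluctuation and the truncation bias.\<close>
  have "T2 \<omega> \<le> (\<Sum>i<n. \<bar>(w (\<omega> i))\<^sup>2 - (u (\<omega> i))\<^sup>2\<bar>) + (\<Sum>i<n. (u (\<omega> i))\<^sup>2 - Y (\<omega> i))
      + \<bar>(\<Sum>i<n. Y (\<omega> i)) - n * expectation Y\<bar> + V" for \<omega>
  proof -
    have "(\<Sum>i<n. (w (\<omega> i))\<^sup>2) - \<sigma>2 = (\<Sum>i<n. (w (\<omega> i))\<^sup>2 - (u (\<omega> i))\<^sup>2) + (\<Sum>i<n. (u (\<omega> i))\<^sup>2 - Y (\<omega> i))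
      + ((\<Sum>i<n. Y (\<omega> i)) - n * expectation Y) + (n * expectation Y - \<sigma>2)"
      by (simp add: sum_subtractf)
    moreover have "\<bar>n * expectation Y - \<sigma>2\<bar> \<le> V"
      using b22 EY uYpos by (simp add: abs_mult)
    moreover have "\<bar>\<Sum>i<n. (w (\<omega> i))\<^sup>2 - (u (\<omega> i))\<^sup>2\<bar> \<le> (\<Sum>i<n. \<bar>(w (\<omega> i))\<^sup>2 - (u (\<omega> i))\<^sup>2\<bar>)"
      by (rule sum_abs)
    moreover have "0 \<le> (\<Sum>i<n. (u (\<omega> i))\<^sup>2 - Y (\<omega> i))" by (rule sum_nonneg) (rule uYpos)
    ultimately show ?thesis unfolding T2_def by linarith
  qed
  then have "(LINT \<omega>|P. T2 \<omega>) \<le> (LINT \<omega>|P. (\<Sum>i<n. \<bar>(w (\<omega> i))\<^sup>2 - (u (\<omega> i))\<^sup>2\<bar>) + (\<Sum>i<n. (u (\<omega> i))\<^sup>2 - Y (\<omega> i))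
      + \<bar>(\<Sum>i<n. Y (\<omega> i)) - n * expectation Y\<bar> + V)"
    using i2 iid_sum_P(1)[OF wu1] iid_sum_P(1)[OF uY] iid_sum_P(1)[OF Y1]
    by (intro integral_mono) auto
  also have "\<dots> = n * expectation (\<lambda>x. \<bar>(w x)\<^sup>2 - (u x)\<^sup>2\<bar>) + n * expectation (\<lambda>x. (u x)\<^sup>2 - Y x)
      + (LINT \<omega>|P. \<bar>(\<Sum>i<n. Y (\<omega> i)) - n * expectation Y\<bar>) + V"
    using iid_sum_P[OF wu1] iid_sum_P[OF uY] iid_sum_P(1)[OF Y1] by (simp add: P.prob_space)
  also have "\<dots> \<le> d + 2 * sqrt (\<sigma>2 * d) + 2 * V + sqrt V" using b21 b22 b23 by linarith
  finally have b2: "(LINT \<omega>|P. T2 \<omega>) \<le> d + 2 * sqrt (\<sigma>2 * d) + 2 * V + sqrt V" .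

  have "(LINT \<omega>|P. T3 \<omega>) = n * expectation (\<lambda>x. (w x)\<^sup>2 * min 1 \<bar>w x\<bar>)"
    unfolding T3_def by (rule iid_sum_P(2)[OF Z1])
  also have "\<dots> \<le> n * expectation (\<lambda>x. 2 * (D x)\<^sup>2 + 4 * v x + 2 * (\<bar>u x\<bar> * \<bar>D x\<bar>))"
    unfolding D_def v_def by (intro mult_left_mono integral_mono truncation_bounds(3))
      (use Z1 D2 v1 uD in \<open>auto simp: D_def v_def[abs_def]\<close>)
  also have "\<dots> = 2 * d + 4 * V + 2 * (n * expectation (\<lambda>x. \<bar>u x\<bar> * \<bar>D x\<bar>))"
    using D2 v1 uD by (simp add: d V distrib_left)
  also have "\<dots> \<le> 2 * d + 4 * V + 2 * sqrt (\<sigma>2 * d)" using CS by linarith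
  finally have b3: "(LINT \<omega>|P. T3 \<omega>) \<le> 2 * d + 4 * V + 2 * sqrt (\<sigma>2 * d)" .

  have "(LINT \<omega>|P. T \<omega>) = (LINT \<omega>|P. T1 \<omega>) + (LINT \<omega>|P. T2 \<omega>) / 4 + (LINT \<omega>|P. T3 \<omega>)"
    unfolding T using i1 i2 i3 by simp
  also have "\<dots> \<le> (sqrt d + \<bar>n * expectation w + \<sigma>2 / 4\<bar>)
      + (d + 2 * sqrt (\<sigma>2 * d) + 2 * V + sqrt V) / 4 + (2 * d + 4 * V + 2 * sqrt (\<sigma>2 * d))"
    by (intro add_mono divide_right_mono b1 b2 b3) simp
  finally show "(LINT \<omega>|P. T \<omega>) \<le> sqrt d + \<bar>n * expectation w + \<sigma>2 / 4\<bar>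
      + (d + 2 * sqrt (\<sigma>2 * d) + 2 * V + sqrt V) / 4 + (2 * d + 4 * V + 2 * sqrt (\<sigma>2 * d))" .
qed

text \<open>Markov's inequality for the total error \<open>T\<close>, whose mean tends to 0. Failure
  of \<open>\<bar>w\<bar> \<le> 1\<close> is made part of the bad event because only where this
  bound holds is the argument of the logarithm known to be positive.\<close>

lemma iid_log_expansion:
  fixes s :: "'a \<Rightarrow> real" and w :: "nat \<Rightarrow> 'a \<Rightarrow> real" and \<sigma>2 \<epsilon> :: real
  defines "P \<equiv> \<lambda>n. Pi\<^sub>M {..<n} (\<lambda>_. M)"
  assumes [measurable]: "s \<in> borel_measurable M" and s: "integrable M (\<lambda>x. (s x)\<^sup>2)"
    and s0: "expectation s = 0" and \<sigma>2: "expectation (\<lambda>x. (s x)\<^sup>2) = \<sigma>2"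
    and w: "\<forall>\<^sub>F n in sequentially. w n \<in> borel_measurable M \<and> integrable M (\<lambda>x. (w n x)\<^sup>2)"
    and lim: "(\<lambda>n. n * expectation (\<lambda>x. (w n x - s x / sqrt n)\<^sup>2)) \<longlonglongrightarrow> 0"
    and mean: "(\<lambda>n. n * expectation (w n)) \<longlonglongrightarrow> - \<sigma>2 / 4"
    and \<epsilon>: "0 < \<epsilon>"
  shows "(\<lambda>n. measure (P n) {\<omega> \<in> space (P n). \<not> ((\<forall>i<n. \<bar>w n (\<omega> i)\<bar> \<le> 1) \<and>
      \<bar>(\<Sum>i<n. 2 * ln (1 + w n (\<omega> i) / 2)) - ((\<Sum>i<n. s (\<omega> i)) / sqrt n - \<sigma>2 / 2)\<bar> \<le> \<epsilon>)}) \<longlonglongrightarrow> 0"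
    (is "(\<lambda>n. measure (P n) (?B n)) \<longlonglongrightarrow> 0")
proof (rule Lim_null_comparison)
  define d V where "d n = n * expectation (\<lambda>x. (w n x - s x / sqrt n)\<^sup>2)"
    and "V n = expectation (\<lambda>x. (s x)\<^sup>2 * min 1 \<bar>s x / sqrt (real n)\<bar>)" for n :: nat
  define b where "b n = sqrt (d n) + \<bar>n * expectation (w n) + \<sigma>2 / 4\<bar>
      + (d n + 2 * sqrt (\<sigma>2 * d n) + 2 * V n + sqrt (V n)) / 4 + (2 * d n + 4 * V n + 2 * sqrt (\<sigma>2 * d n))"
    for n
  have "d \<longlonglongrightarrow> 0" using lim by (simp add: d_def[abs_def])
  moreover have "V \<longlonglongrightarrow> 0" unfolding V_def[abs_def] by (rule truncated_second_moment_tendsto_0) (use s in auto)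
  moreover have "(\<lambda>n. n * expectation (w n) + \<sigma>2 / 4) \<longlonglongrightarrow> 0"
    using tendsto_add[OF mean tendsto_const[of "\<sigma>2 / 4"]] by simp
  ultimately have "b \<longlonglongrightarrow> sqrt 0 + \<bar>0\<bar> + (0 + 2 * sqrt (\<sigma>2 * 0) + 2 * 0 + sqrt 0) / 4 + (2 * 0 + 4 * 0 + 2 * sqrt (\<sigma>2 * 0))"
    unfolding b_def[abs_def] by (intro tendsto_intros) auto
  then have "b \<longlonglongrightarrow> 0" by simp
  then show "(\<lambda>n. b n / min 1 \<epsilon>) \<longlonglongrightarrow> 0" by (rule tendsto_divide_zero)
  show "\<forall>\<^sub>F n in sequentially. norm (measure (P n) (?B n)) \<le> b n / min 1 \<epsilon>"
    using w eventually_gt_at_top[of 0]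
  proof eventually_elim
    case (elim n)
    interpret P: prob_space "P n" unfolding P_def by (rule prob_space_iid)
    define u where "u x = s x / sqrt n" for x
    have [measurable]: "w n \<in> borel_measurable M" "u \<in> borel_measurable M"
      using elim unfolding u_def by auto
    have u2: "(u x)\<^sup>2 = (s x)\<^sup>2 / n" for x by (simp add: u_def power_divide)
    have eV: "n * expectation (\<lambda>x. (u x)\<^sup>2 * min 1 \<bar>u x\<bar>) = V n"
    proof -
      have "expectation (\<lambda>x. (u x)\<^sup>2 * min 1 \<bar>u x\<bar>) = expectation (\<lambda>x. (s x)\<^sup>2 * min 1 \<bar>s x / sqrt n\<bar> / n)"
        by (simp add: u2) (simp add: u_def)
      then show ?thesis using elim by (simp add: V_def)
    qed
    have ed: "n * expectation (\<lambda>x. (w n x - u x)\<^sup>2) = d n" by (simp add: u_def d_def)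
    have eu: "integrable M (\<lambda>x. (u x)\<^sup>2)" "expectation u = 0" "n * expectation (\<lambda>x. (u x)\<^sup>2) = \<sigma>2"
      using elim s \<sigma>2 s0 by (simp_all add: u2) (simp add: u_def[abs_def])
    define T where "T \<omega> = \<bar>(\<Sum>i<n. w n (\<omega> i) - u (\<omega> i)) + \<sigma>2 / 4\<bar> + \<bar>(\<Sum>i<n. (w n (\<omega> i))\<^sup>2) - \<sigma>2\<bar> / 4
      + (\<Sum>i<n. (w n (\<omega> i))\<^sup>2 * min 1 \<bar>w n (\<omega> i)\<bar>)" for \<omega>
    have T: "integrable (P n) T" "(LINT \<omega>|P n. T \<omega>) \<le> b n"
      using iid_log_expansion_error[of u "w n" n \<sigma>2, OF _ _ eu(1) _ eu(2,3)] elim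
      unfolding eV ed T_def[abs_def] b_def P_def by simp_all
    have [measurable]: "T \<in> borel_measurable (P n)" using T by auto
    have T_nonneg: "0 \<le> T \<omega>" for \<omega> unfolding T_def by (auto intro!: add_nonneg_nonneg sum_nonneg)
    \<comment> \<open>The level \<open>min 1 \<epsilon>\<close> serves two ends:
      \<open>T < 1\<close> makes the Taylor expansion applicable at every sample point, and
      \<open>T < \<epsilon>\<close> is the accuracy requested.\<close>
    have sub: "?B n \<subseteq> {\<omega> \<in> space (P n). T \<omega> \<ge> min 1 \<epsilon>}"
    proof (rule subsetI, rule ccontr)
      fix \<omega> assume B: "\<omega> \<in> ?B n" and "\<omega> \<notin> {\<omega> \<in> space (P n). T \<omega> \<ge> min 1 \<epsilon>}"
      then have \<omega>: "\<omega> \<in> space (P n)" "\<not> min 1 \<epsilon> \<le> T \<omega>" by auto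
      define z where "z = (\<Sum>i<n. (w n (\<omega> i))\<^sup>2 * min 1 \<bar>w n (\<omega> i)\<bar>)"
      have z: "z \<le> T \<omega>" unfolding T_def z_def by simp
      with \<omega> have "z < 1" by auto
      note ex = sum_ln_expansion[of "\<lambda>i. w n (\<omega> i)" n, folded z_def, OF this]
      have "\<bar>(\<Sum>i<n. 2 * ln (1 + w n (\<omega> i) / 2)) - ((\<Sum>i<n. u (\<omega> i)) - \<sigma>2 / 2)\<bar> \<le> T \<omega>"
      proof -
        \<comment> \<open>The three errors are arranged so that the two quarters of
          \<open>\<sigma>2\<close>, one in \<open>b\<close> and one from \<open>c / 4\<close>, add
          up to \<open>\<sigma>2 / 2\<close>.\<close>
        define a b c where "a = (\<Sum>i<n. 2 * ln (1 + w n (\<omega> i) / 2)) - (\<Sum>i<n. w n (\<omega> i)) + (\<Sum>i<n. (w n (\<omega> i))\<^sup>2) / 4"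
          and "b = (\<Sum>i<n. w n (\<omega> i) - u (\<omega> i)) + \<sigma>2 / 4" and "c = (\<Sum>i<n. (w n (\<omega> i))\<^sup>2) - \<sigma>2"
        have "(\<Sum>i<n. 2 * ln (1 + w n (\<omega> i) / 2)) - ((\<Sum>i<n. u (\<omega> i)) - \<sigma>2 / 2) = a + b - c / 4"
          by (simp add: a_def b_def c_def sum_subtractf field_simps)
        moreover have "\<bar>a\<bar> \<le> z" using ex(2) by (simp add: a_def)
        moreover have "T \<omega> = \<bar>b\<bar> + \<bar>c\<bar> / 4 + z" by (simp add: T_def b_def c_def z_def)
        ultimately show ?thesis by linarith
      qed
      also have "\<dots> \<le> \<epsilon>" using \<omega> by auto
      finally have "\<bar>(\<Sum>i<n. 2 * ln (1 + w n (\<omega> i) / 2)) - ((\<Sum>i<n. s (\<omega> i)) / sqrt n - \<sigma>2 / 2)\<bar> \<le> \<epsilon>"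
        by (simp add: u_def sum_divide_distrib)
      with B ex(1) show False by blast
    qed
    have "measure (P n) (?B n) \<le> measure (P n) {\<omega> \<in> space (P n). T \<omega> \<ge> min 1 \<epsilon>}"
      by (rule P.finite_measure_mono[OF sub]) measurable
    also have "\<dots> \<le> (LINT \<omega>|P n. T \<omega>) / min 1 \<epsilon>"
      by (rule integral_Markov_inequality_measure[where A = "{}"]) (use T T_nonneg \<epsilon> in auto)
    also have "\<dots> \<le> b n / min 1 \<epsilon>" using T \<epsilon> by (intro divide_right_mono) auto
    finally show ?case by simp
  qed
qed

end

subsection \<open>Likelihood ratios of product measures\<close>

text \<open>Both measures agree on boxes, where the integrand factorises. Sigma-finiteness of the
  weighted measure is an assumption of its own so that the lemma also covers weights that do not
  produce a probability measure, such as restrictions.\<close>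

lemma density_PiM:
  fixes f :: "'a \<Rightarrow> ennreal"
  assumes I: "finite I" and M: "sigma_finite_measure M" and f[measurable]: "f \<in> borel_measurable M"
    and fM: "sigma_finite_measure (density M f)"
  shows "density (Pi\<^sub>M I (\<lambda>_. M)) (\<lambda>\<omega>. \<Prod>i\<in>I. f (\<omega> i)) = Pi\<^sub>M I (\<lambda>_. density M f)"
proof -
  interpret M: product_sigma_finite "\<lambda>_. M" using M by (simp add: product_sigma_finite_def)
  interpret fM: product_sigma_finite "\<lambda>_. density M f" using fM by (simp add: product_sigma_finite_def)
  show ?thesis
  proof (rule fM.PiM_eqI[OF I])
    show "sets (density (Pi\<^sub>M I (\<lambda>_. M)) (\<lambda>\<omega>. \<Prod>i\<in>I. f (\<omega> i))) = sets (Pi\<^sub>M I (\<lambda>_. density M f))"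
      by (simp cong: sets_PiM_cong)
    fix A assume "\<And>i. i \<in> I \<Longrightarrow> A i \<in> sets (density M f)"
    then have A[measurable]: "A i \<in> sets M" if "i \<in> I" for i using that by simp
    have box: "Pi\<^sub>E I A \<in> sets (Pi\<^sub>M I (\<lambda>_. M))" using I A by (intro sets_PiM_I_finite) auto
    \<comment> \<open>Points of the product space are extensional, so membership in the box is
      decided by the coordinates in \<open>I\<close>; a coordinate outside its side contributes a
      zero factor.\<close>
    have ind: "(\<Prod>i\<in>I. indicator (A i) (\<omega> i)) = (indicator (Pi\<^sub>E I A) \<omega> :: ennreal)"
      if "\<omega> \<in> space (Pi\<^sub>M I (\<lambda>_. M))" for \<omega>
      using that I by (auto simp: indicator_def PiE_iff space_PiM prod.neutral
          intro!: prod_zero split: if_splits)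
    have "emeasure (density (Pi\<^sub>M I (\<lambda>_. M)) (\<lambda>\<omega>. \<Prod>i\<in>I. f (\<omega> i))) (Pi\<^sub>E I A)
        = (\<integral>\<^sup>+\<omega>. (\<Prod>i\<in>I. f (\<omega> i)) * indicator (Pi\<^sub>E I A) \<omega> \<partial>Pi\<^sub>M I (\<lambda>_. M))"
      using box by (subst emeasure_density) auto
    also have "\<dots> = (\<integral>\<^sup>+\<omega>. (\<Prod>i\<in>I. f (\<omega> i) * indicator (A i) (\<omega> i)) \<partial>Pi\<^sub>M I (\<lambda>_. M))"
      by (intro nn_integral_cong) (simp add: prod.distrib ind)
    also have "\<dots> = (\<Prod>i\<in>I. \<integral>\<^sup>+x. f x * indicator (A i) x \<partial>M)"
      using I by (subst M.product_nn_integral_prod[where f = "\<lambda>i x. f x * indicator (A i) x"]) auto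
    also have "\<dots> = (\<Prod>i\<in>I. emeasure (density M f) (A i))"
      by (intro prod.cong) (auto simp: emeasure_density)
    finally show "emeasure (density (Pi\<^sub>M I (\<lambda>_. M)) (\<lambda>\<omega>. \<Prod>i\<in>I. f (\<omega> i))) (Pi\<^sub>E I A)
        = (\<Prod>i\<in>I. emeasure (density M f) (A i))" .
  qed
qed

section \<open>The likelihood ratio as density of the absolutely continuous part\<close>

text \<open>Uniqueness in the Lebesgue decomposition. The given \<open>f\<close> shows that the
  choice in \<open>lik_ratio\<close> has a witness; the chosen function may come with another null
  set \<open>N'\<close>, but away from \<open>N \<union> N'\<close> both densities reproduce
  \<open>Q\<close>.\<close>

lemma lik_ratio_AE_eq:
  assumes P: "sigma_finite_measure P"
    and f[measurable]: "f \<in> borel_measurable P" and N: "N \<in> null_sets P"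
    and Q: "\<And>A. A \<in> sets P \<Longrightarrow> emeasure Q A = emeasure (density P f) A + emeasure Q (A \<inter> N)"
  shows "lik_ratio P Q \<in> borel_measurable P" "AE x in P. lik_ratio P Q x = f x"
proof -
  have "\<exists>f. f \<in> borel_measurable P \<and> (\<exists>N\<in>null_sets P. \<forall>A\<in>sets P.
      emeasure Q A = emeasure (density P f) A + emeasure Q (A \<inter> N))"
    using f N Q by blast
  then have L: "lik_ratio P Q \<in> borel_measurable P \<and> (\<exists>N\<in>null_sets P. \<forall>A\<in>sets P.
      emeasure Q A = emeasure (density P (lik_ratio P Q)) A + emeasure Q (A \<inter> N))"
    unfolding lik_ratio_def by (rule someI_ex)
  then show [measurable]: "lik_ratio P Q \<in> borel_measurable P" ..
  from L obtain N' where N': "N' \<in> null_sets P" and Q': "\<And>A. A \<in> sets P \<Longrightarrow>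
      emeasure Q A = emeasure (density P (lik_ratio P Q)) A + emeasure Q (A \<inter> N')"
    by auto
  \<comment> \<open>\<open>K\<close> stands for either of the two null sets. Removing their union
    costs nothing under a density of \<open>P\<close> and deletes the singular part of
    \<open>Q\<close>.\<close>
  have off_null: "emeasure (density P h) A = emeasure Q (A - (N \<union> N'))"
    if h[measurable]: "h \<in> borel_measurable P" and A: "A \<in> sets P" and K: "K \<in> null_sets P" "K \<subseteq> N \<union> N'"
      and eq: "\<And>A. A \<in> sets P \<Longrightarrow> emeasure Q A = emeasure (density P h) A + emeasure Q (A \<inter> K)" for h A K
  proof -
    have NN: "N \<union> N' \<in> null_sets P" using N N' by auto
    have "N \<union> N' \<in> null_sets (density P h)"
      using NN by (intro absolutely_continuousI_density[THEN absolutely_continuous_def[THEN iffD1], THEN subsetD]) auto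
    then have "emeasure (density P h) A = emeasure (density P h) (A - (N \<union> N'))"
      using A by (subst emeasure_Diff_null_set) auto
    also have "\<dots> = emeasure Q (A - (N \<union> N'))"
    proof -
      have "(A - (N \<union> N')) \<inter> K = {}" using K by auto
      then show ?thesis using eq[of "A - (N \<union> N')"] A NN by (auto simp: null_sets_def)
    qed
    finally show ?thesis .
  qed
  have "density P (lik_ratio P Q) = density P f"
  proof (rule measure_eqI)
    fix A assume "A \<in> sets (density P (lik_ratio P Q))"
    then have A: "A \<in> sets P" by simp
    show "emeasure (density P (lik_ratio P Q)) A = emeasure (density P f) A"
      using off_null[OF _ A N' _ Q'] off_null[OF f A N _ Q] by simp
  qed simp
  then show "AE x in P. lik_ratio P Q x = f x"
    by (intro sigma_finite_measure.density_unique[OF P]) auto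
qed

lemma borel_measurable_log_ennreal[measurable]: "log_ennreal \<in> borel_measurable borel"
  unfolding log_ennreal_def[abs_def] by measurable

text \<open>The absolutely continuous part of \<open>Q\<close> is its restriction to the event that
  \<open>p\<close> is positive at all observations. This restriction is again a product, and
  coordinate by coordinate it has density \<open>q / p\<close> with respect to the null law. The
  complementary event is null under \<open>P\<close> and carries the rest of
  \<open>Q\<close>.\<close>

lemma lik_ratio_iid:
  fixes M :: "'a measure" and p q :: "'a \<Rightarrow> real" and n :: nat
  defines "P \<equiv> Pi\<^sub>M {..<n} (\<lambda>_. density M (\<lambda>x. ennreal (p x)))"
    and "Q \<equiv> Pi\<^sub>M {..<n} (\<lambda>_. density M (\<lambda>x. ennreal (q x)))"
  assumes [measurable]: "p \<in> borel_measurable M" "q \<in> borel_measurable M"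
    and p: "\<And>x. x \<in> space M \<Longrightarrow> 0 \<le> p x" and q: "\<And>x. x \<in> space M \<Longrightarrow> 0 \<le> q x"
    and P: "prob_space (density M (\<lambda>x. ennreal (p x)))"
    and Q: "prob_space (density M (\<lambda>x. ennreal (q x)))"
  shows "lik_ratio P Q \<in> borel_measurable P"
    and "AE \<omega> in P. lik_ratio P Q \<omega> = (\<Prod>i<n. ennreal (q (\<omega> i) / p (\<omega> i)))"
    and "AE \<omega> in P. \<forall>i<n. 0 < p (\<omega> i)"
proof -
  define M0 M1 where "M0 = density M (\<lambda>x. ennreal (p x))" and "M1 = density M (\<lambda>x. ennreal (q x))"
  have P_eq: "P = Pi\<^sub>M {..<n} (\<lambda>_. M0)" and Q_eq: "Q = Pi\<^sub>M {..<n} (\<lambda>_. M1)"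
    by (simp_all add: P_def Q_def M0_def M1_def)
  interpret M0: prob_space M0 unfolding M0_def by (rule P)
  interpret M1: prob_space M1 unfolding M1_def by (rule Q)
  interpret P: prob_space P unfolding P_eq by (rule M0.prob_space_iid)
  have setsM: "sets M0 = sets M" "sets M1 = sets M" by (simp_all add: M0_def M1_def)
  have sets: "sets Q = sets P" unfolding P_eq Q_eq by (intro sets_PiM_cong) (simp_all add: setsM)
  have space: "space Q = space P" using sets by (rule sets_eq_imp_space_eq)
  define r \<kappa> where "r x = ennreal (q x / p x)" and "\<kappa> x = (indicator {x. 0 < p x} x :: ennreal)" for x
  have [measurable]: "r \<in> borel_measurable M" "\<kappa> \<in> borel_measurable M"
    unfolding r_def \<kappa>_def[abs_def] by measurable
  have [measurable]: "r \<in> borel_measurable M0" "\<kappa> \<in> borel_measurable M1"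
    "p \<in> borel_measurable M0" "p \<in> borel_measurable M1"
    by (simp_all add: M0_def M1_def)
  have r\<kappa>: "density M0 r = density M1 \<kappa>"
  proof -
    have "AE x in M. ennreal (p x) * r x = ennreal (q x) * \<kappa> x"
      using p q by (intro AE_I2) (auto simp: r_def \<kappa>_def indicator_def order_less_le simp flip: ennreal_mult)
    then show ?thesis
      unfolding M0_def M1_def by (simp add: density_density_eq) (rule density_cong, auto)
  qed
  \<comment> \<open>The restricted law may have mass below 1; finiteness suffices for the product
    formula.\<close>
  have "emeasure (density M1 \<kappa>) (space M1) \<le> (\<integral>\<^sup>+x. indicator (space M1) x \<partial>M1)"
    by (subst emeasure_density, simp, simp, rule nn_integral_mono) (auto simp: \<kappa>_def split: split_indicator)
  then have fin: "finite_measure (density M1 \<kappa>)"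
    by (intro finite_measureI) (auto simp: M1.emeasure_space_1 top_unique)
  have pos: "AE x in M0. 0 < p x"
    using p unfolding M0_def by (subst AE_density) (auto intro!: AE_I2)
  have "AE \<omega> in P. \<forall>i\<in>{..<n}. 0 < p (\<omega> i)"
    unfolding P_eq using pos by (intro AE_finite_allI AE_PiM_component M0.prob_space_axioms) auto
  then show pos': "AE \<omega> in P. \<forall>i<n. 0 < p (\<omega> i)" by (rule eventually_mono) simp
  define N where "N = {\<omega> \<in> space P. \<not> (\<forall>i<n. 0 < p (\<omega> i))}"
  have [measurable]: "N \<in> sets P" unfolding N_def P_eq by measurable
  have N: "N \<in> null_sets P"
  proof (subst AE_iff_null_sets[OF \<open>N \<in> sets P\<close>])
    show "AE \<omega> in P. \<omega> \<notin> N" using pos' by eventually_elim (simp add: N_def)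
  qed
  have f: "(\<lambda>\<omega>. \<Prod>i<n. r (\<omega> i)) \<in> borel_measurable P" unfolding P_eq by measurable
  have dens: "density P (\<lambda>\<omega>. \<Prod>i<n. r (\<omega> i)) = density Q (\<lambda>\<omega>. \<Prod>i<n. \<kappa> (\<omega> i))"
    unfolding P_eq Q_eq
    using density_PiM[of "{..<n}" M0 r] density_PiM[of "{..<n}" M1 \<kappa>] fin
    by (simp add: M0.sigma_finite_measure_axioms M1.sigma_finite_measure_axioms r\<kappa>
        finite_measure.axioms(1) finite_measure_def)
  have Q_meas: "(\<lambda>\<omega>. \<Prod>i<n. \<kappa> (\<omega> i)) \<in> borel_measurable Q" unfolding Q_eq by measurable
  have split: "emeasure Q A = emeasure (density Q (\<lambda>\<omega>. \<Prod>i<n. \<kappa> (\<omega> i))) A + emeasure Q (A \<inter> N)"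
    if A: "A \<in> sets P" for A
  proof -
    have "(\<Prod>i<n. \<kappa> (\<omega> i)) * indicator A \<omega> = (indicator (A - N) \<omega> :: ennreal)" if "\<omega> \<in> space Q" for \<omega>
      using that by (auto simp: space \<kappa>_def indicator_def N_def intro!: prod.neutral)
    then have "emeasure (density Q (\<lambda>\<omega>. \<Prod>i<n. \<kappa> (\<omega> i))) A = (\<integral>\<^sup>+\<omega>. indicator (A - N) \<omega> \<partial>Q)"
      using A sets by (subst emeasure_density) (simp_all add: Q_meas cong: nn_integral_cong)
    also have "\<dots> = emeasure Q (A - N)"
      using A sets \<open>N \<in> sets P\<close> by (intro nn_integral_indicator) auto
    finally have "emeasure (density Q (\<lambda>\<omega>. \<Prod>i<n. \<kappa> (\<omega> i))) A + emeasure Q (A \<inter> N)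
        = emeasure Q (A - N) + emeasure Q (A \<inter> N)" by simp
    also have "\<dots> = emeasure Q ((A - N) \<union> (A \<inter> N))"
      using A sets \<open>N \<in> sets P\<close> by (intro plus_emeasure) auto
    finally show ?thesis by (simp add: Un_Diff_Int)
  qed
  have *: "emeasure Q A = emeasure (density P (\<lambda>\<omega>. \<Prod>i<n. r (\<omega> i))) A + emeasure Q (A \<inter> N)"
    if "A \<in> sets P" for A unfolding dens by (rule split[OF that])
  note lr = lik_ratio_AE_eq[OF P.sigma_finite_measure_axioms f N *]
  show "lik_ratio P Q \<in> borel_measurable P" by (rule lr(1))
  show "AE \<omega> in P. lik_ratio P Q \<omega> = (\<Prod>i<n. ennreal (q (\<omega> i) / p (\<omega> i)))"
    using lr(2) by (simp only: r_def)
qed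

subsection \<open>Differentiability in quadratic mean\<close>

lemma prob_density_integral:
  fixes f :: "'a \<Rightarrow> real"
  assumes [measurable]: "f \<in> borel_measurable M" and f: "\<And>x. x \<in> space M \<Longrightarrow> 0 \<le> f x"
    and P: "prob_space (density M (\<lambda>x. ennreal (f x)))"
  shows "integrable M f" "(LINT x|M. f x) = 1"
proof -
  interpret prob_space "density M (\<lambda>x. ennreal (f x))" by (rule P)
  have "(\<integral>\<^sup>+x. ennreal (f x) \<partial>M) = (\<integral>\<^sup>+x. ennreal (f x) * indicator (space M) x \<partial>M)"
    by (rule nn_integral_cong) simp
  also have "\<dots> = emeasure (density M (\<lambda>x. ennreal (f x))) (space M)"
    by (rule emeasure_density[symmetric]) auto
  also have "\<dots> = 1" using emeasure_space_1 by simp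
  finally have "(\<integral>\<^sup>+x. ennreal (f x) \<partial>M) = 1" .
  then have "has_bochner_integral M f 1"
    using f by (intro has_bochner_integral_nn_integral) auto
  then show "integrable M f" "(LINT x|M. f x) = 1"
    by (auto simp: has_bochner_integral_iff)
qed

text \<open>Both identities come from expanding with the two unit masses. Together they say that a
  chord of the unit sphere from \<open>sqrt p\<close> to \<open>sqrt q\<close> has inner product
  with \<open>sqrt p\<close> equal to minus half its squared length.\<close>

lemma Hellinger_affinity:
  fixes p q :: "'a \<Rightarrow> real"
  assumes [measurable]: "p \<in> borel_measurable M" "q \<in> borel_measurable M"
    and p: "\<And>x. x \<in> space M \<Longrightarrow> 0 \<le> p x" and q: "\<And>x. x \<in> space M \<Longrightarrow> 0 \<le> q x"
    and P: "prob_space (density M (\<lambda>x. ennreal (p x)))"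
    and Q: "prob_space (density M (\<lambda>x. ennreal (q x)))"
  shows "integrable M (\<lambda>x. (sqrt (p x))\<^sup>2)" "integrable M (\<lambda>x. (sqrt (q x))\<^sup>2)"
    and "integrable M (\<lambda>x. sqrt (q x) * sqrt (p x))"
    and "(LINT x|M. (sqrt (q x) - sqrt (p x))\<^sup>2) = 2 - 2 * (LINT x|M. sqrt (q x) * sqrt (p x))"
    and "(LINT x|M. (sqrt (q x) - sqrt (p x)) * sqrt (p x)) = (LINT x|M. sqrt (q x) * sqrt (p x)) - 1"
proof -
  have eq: "integrable M (\<lambda>x. (sqrt (f x))\<^sup>2) \<and> (LINT x|M. (sqrt (f x))\<^sup>2) = 1"
    if "f \<in> borel_measurable M" "\<And>x. x \<in> space M \<Longrightarrow> 0 \<le> f x"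
      "prob_space (density M (\<lambda>x. ennreal (f x)))" for f :: "'a \<Rightarrow> real"
    using prob_density_integral[OF that] that(2)
      Bochner_Integration.integrable_cong[OF refl, of M "\<lambda>x. (sqrt (f x))\<^sup>2" f]
      Bochner_Integration.integral_cong[OF refl, of M "\<lambda>x. (sqrt (f x))\<^sup>2" f] by simp
  show p2: "integrable M (\<lambda>x. (sqrt (p x))\<^sup>2)" and q2: "integrable M (\<lambda>x. (sqrt (q x))\<^sup>2)"
    using eq p q P Q by auto
  show pq: "integrable M (\<lambda>x. sqrt (q x) * sqrt (p x))" by (rule integrable_mult_L2) (use p2 q2 in auto)
  have 1: "(LINT x|M. (sqrt (p x))\<^sup>2) = 1" "(LINT x|M. (sqrt (q x))\<^sup>2) = 1" using eq p q P Q by auto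
  show "(LINT x|M. (sqrt (q x) - sqrt (p x))\<^sup>2) = 2 - 2 * (LINT x|M. sqrt (q x) * sqrt (p x))"
    using p2 q2 pq 1 by (simp add: power2_diff mult.assoc)
  show "(LINT x|M. (sqrt (q x) - sqrt (p x)) * sqrt (p x)) = (LINT x|M. sqrt (q x) * sqrt (p x)) - 1"
    using p2 pq 1 by (simp add: left_diff_distrib power2_eq_square)
qed

lemma tendsto_0_sqrt_scaling:
  fixes a :: "nat \<Rightarrow> real"
  assumes "(\<lambda>n. n * a n) \<longlonglongrightarrow> L"
  shows "(\<lambda>n. sqrt n * a n) \<longlonglongrightarrow> 0"
proof (rule Lim_transform_eventually)
  have "(\<lambda>n. 1 / sqrt (real n)) \<longlonglongrightarrow> 0" by real_asymp
  from tendsto_mult[OF this assms] show "(\<lambda>n. 1 / sqrt (real n) * (n * a n)) \<longlonglongrightarrow> 0" by simp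
  show "\<forall>\<^sub>F n in sequentially. 1 / sqrt (real n) * (n * a n) = sqrt n * a n"
    using eventually_gt_at_top[of 0]
  proof eventually_elim
    case (elim n)
    have "1 / sqrt (real n) * (n * a n) = (real n / sqrt n) * a n" by simp
    also have "real n / sqrt n = sqrt n" by (rule real_div_sqrt) simp
    finally show ?case .
  qed
qed

text \<open>The rescaled chord converges to \<open>g\<close> in L2. Comparing squared lengths gives
  the limit of the affinity. The component along \<open>sqrt p\<close> is quadratic in the chord,
  hence one power of \<open>sqrt n\<close> too small to survive, so the tangent \<open>g\<close> is
  orthogonal to \<open>sqrt p\<close>.\<close>

lemma DQM_consequences:
  fixes p g :: "'a \<Rightarrow> real" and q :: "nat \<Rightarrow> 'a \<Rightarrow> real"
  assumes p_meas[measurable]: "p \<in> borel_measurable M" and p: "\<And>x. x \<in> space M \<Longrightarrow> 0 \<le> p x"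
    and P: "prob_space (density M (\<lambda>x. ennreal (p x)))"
    and q: "\<forall>\<^sub>F n in sequentially. q n \<in> borel_measurable M \<and> (\<forall>x\<in>space M. 0 \<le> q n x) \<and>
      prob_space (density M (\<lambda>x. ennreal (q n x)))"
    and [measurable]: "g \<in> borel_measurable M" and g: "integrable M (\<lambda>x. (g x)\<^sup>2)"
    and lim: "(\<lambda>n. n * (LINT x|M. (sqrt (q n x) - sqrt (p x) - g x / sqrt n)\<^sup>2)) \<longlonglongrightarrow> 0"
  shows DQM_affinity: "(\<lambda>n. n * (2 * (LINT x|M. sqrt (q n x) * sqrt (p x)) - 2)) \<longlonglongrightarrow> - (LINT x|M. (g x)\<^sup>2)"
    and DQM_mean_zero: "(LINT x|M. g x * sqrt (p x)) = 0"
proof -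
  define f where "f n x = sqrt n * (sqrt (q n x) - sqrt (p x))" for n :: nat and x
  have f2: "(f n x)\<^sup>2 = n * (sqrt (q n x) - sqrt (p x))\<^sup>2" for n x by (simp add: f_def power_mult_distrib)
  have f: "\<forall>\<^sub>F n in sequentially. f n \<in> borel_measurable M \<and> integrable M (\<lambda>x. (f n x)\<^sup>2)"
    using q
  proof eventually_elim
    case (elim n)
    then have [measurable]: "q n \<in> borel_measurable M" by simp
    have "integrable M (\<lambda>x. (sqrt (q n x) - sqrt (p x))\<^sup>2)"
      using Hellinger_affinity(1,2)[of p M "q n"] elim p P by (intro integrable_add_L2) auto
    then show ?case unfolding f2 by (simp add: f_def[abs_def])
  qed
  have fg: "(\<lambda>n. LINT x|M. (f n x - g x)\<^sup>2) \<longlonglongrightarrow> 0"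
  proof (rule Lim_transform_eventually[OF lim])
    show "\<forall>\<^sub>F n in sequentially. n * (LINT x|M. (sqrt (q n x) - sqrt (p x) - g x / sqrt n)\<^sup>2)
        = (LINT x|M. (f n x - g x)\<^sup>2)"
      using eventually_gt_at_top[of 0]
    proof eventually_elim
      case (elim n)
      have "n * (sqrt (q n x) - sqrt (p x) - g x / sqrt n)\<^sup>2 = (f n x - g x)\<^sup>2" for x
      proof -
        have "f n x - g x = sqrt n * (sqrt (q n x) - sqrt (p x) - g x / sqrt n)"
          using elim by (simp add: f_def field_simps)
        then show ?thesis using elim by (simp only: power_mult_distrib) simp
      qed
      then have "(LINT x|M. (f n x - g x)\<^sup>2) = (LINT x|M. n * (sqrt (q n x) - sqrt (p x) - g x / sqrt n)\<^sup>2)"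
        by simp
      then show ?case by simp
    qed
  qed
  have norm_lim: "(\<lambda>n. LINT x|M. (f n x)\<^sup>2) \<longlonglongrightarrow> (LINT x|M. (g x)\<^sup>2)"
    by (rule L2_tendsto_norm[OF f _ g fg]) measurable
  have affinity: "\<forall>\<^sub>F n in sequentially. (LINT x|M. (f n x)\<^sup>2) = n * (2 - 2 * (LINT x|M. sqrt (q n x) * sqrt (p x)))"
    and inner: "\<forall>\<^sub>F n in sequentially. (LINT x|M. f n x * sqrt (p x)) = sqrt n * ((LINT x|M. sqrt (q n x) * sqrt (p x)) - 1)"
  proof -
    show "\<forall>\<^sub>F n in sequentially. (LINT x|M. (f n x)\<^sup>2) = n * (2 - 2 * (LINT x|M. sqrt (q n x) * sqrt (p x)))"
      using q
    proof eventually_elim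
      case (elim n)
      show ?case using Hellinger_affinity(4)[of p M "q n"] elim p P by (simp add: f2)
    qed
    show "\<forall>\<^sub>F n in sequentially. (LINT x|M. f n x * sqrt (p x)) = sqrt n * ((LINT x|M. sqrt (q n x) * sqrt (p x)) - 1)"
      using q
    proof eventually_elim
      case (elim n)
      show ?case using Hellinger_affinity(5)[of p M "q n"] elim p P by (simp add: f_def mult.assoc)
    qed
  qed
  show A: "(\<lambda>n. n * (2 * (LINT x|M. sqrt (q n x) * sqrt (p x)) - 2)) \<longlonglongrightarrow> - (LINT x|M. (g x)\<^sup>2)"
    by (rule Lim_transform_eventually[OF tendsto_minus[OF norm_lim]])
      (use affinity in eventually_elim, simp add: algebra_simps)
  have sqrt_p: "(\<lambda>x. sqrt (p x)) \<in> borel_measurable M" "integrable M (\<lambda>x. (sqrt (p x))\<^sup>2)"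
    using Hellinger_affinity(1)[of p M p] p P by auto
  have "(\<lambda>n. LINT x|M. f n x * sqrt (p x)) \<longlonglongrightarrow> (LINT x|M. g x * sqrt (p x))"
    by (rule L2_tendsto_inner[OF f _ g fg sqrt_p]) measurable
  \<comment> \<open>The affinity deficit has order 1/n, and the inner product of the chord with
    \<open>sqrt p\<close> is enlarged only by \<open>sqrt n\<close>.\<close>
  moreover have "(\<lambda>n. sqrt n * (2 * (LINT x|M. sqrt (q n x) * sqrt (p x)) - 2)) \<longlonglongrightarrow> 0"
    by (rule tendsto_0_sqrt_scaling[OF A])
  then have "(\<lambda>n. 1 / 2 * (sqrt n * (2 * (LINT x|M. sqrt (q n x) * sqrt (p x)) - 2))) \<longlonglongrightarrow> 0"
    by (rule tendsto_mult_right_zero)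
  then have "(\<lambda>n. LINT x|M. f n x * sqrt (p x)) \<longlonglongrightarrow> 0"
    by (rule Lim_transform_eventually) (use inner in eventually_elim, simp add: algebra_simps)
  ultimately show "(LINT x|M. g x * sqrt (p x)) = 0" by (rule LIMSEQ_unique)
qed

text \<open>Division by \<open>sqrt p\<close> turns inner products under \<open>M\<close> into inner
  products under the null law. Since the null law ignores the set where \<open>p\<close> is 0,
  \<open>g\<close> has to vanish there for the first two claims; in the third, \<open>sqrt p\<close>
  kills that set on both sides.\<close>

lemma density_div_sqrt:
  fixes M :: "'a measure" and p g k :: "'a \<Rightarrow> real"
  defines "M0 \<equiv> density M (\<lambda>x. ennreal (p x))"
  assumes [measurable]: "p \<in> borel_measurable M" "g \<in> borel_measurable M" "k \<in> borel_measurable M"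
    and p: "\<And>x. x \<in> space M \<Longrightarrow> 0 \<le> p x"
    and g: "integrable M (\<lambda>x. (g x)\<^sup>2)" and k: "integrable M (\<lambda>x. (k x)\<^sup>2)"
    and g0: "AE x in M. p x = 0 \<longrightarrow> g x = 0"
  shows "integrable M0 (\<lambda>x. (g x / sqrt (p x)) * (k x / sqrt (p x)))"
    and "(LINT x|M0. (g x / sqrt (p x)) * (k x / sqrt (p x))) = (LINT x|M. g x * k x)"
    and "(LINT x|M0. g x / sqrt (p x)) = (LINT x|M. g x * sqrt (p x))"
proof -
  have ae: "AE x in M. p x * ((g x / sqrt (p x)) * (k x / sqrt (p x))) = g x * k x"
    using g0 AE_space
  proof eventually_elim
    case (elim x)
    then show ?case using p[of x] by (cases "p x = 0") auto
  qed
  have pos: "AE x in M. 0 \<le> p x" using p by auto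
  have gk: "integrable M (\<lambda>x. g x * k x)" by (rule integrable_mult_L2) (use g k in auto)
  have "integrable M (\<lambda>x. p x * ((g x / sqrt (p x)) * (k x / sqrt (p x))))"
    by (subst integrable_cong_AE[OF _ _ ae]) (use gk in auto)
  then show "integrable M0 (\<lambda>x. (g x / sqrt (p x)) * (k x / sqrt (p x)))"
    unfolding M0_def by (subst integrable_density) (use pos in auto)
  have "(LINT x|M. p x * ((g x / sqrt (p x)) * (k x / sqrt (p x)))) = (LINT x|M. g x * k x)"
    by (rule integral_cong_AE[OF _ _ ae]) auto
  then show "(LINT x|M0. (g x / sqrt (p x)) * (k x / sqrt (p x))) = (LINT x|M. g x * k x)"
    unfolding M0_def by (subst integral_density) (use pos in auto)
  have "(LINT x|M. p x * (g x / sqrt (p x))) = (LINT x|M. g x * sqrt (p x))"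
  proof (rule Bochner_Integration.integral_cong[OF refl])
    fix x assume "x \<in> space M"
    then have "p x / sqrt (p x) = sqrt (p x)" by (intro real_div_sqrt p)
    moreover have "p x * (g x / sqrt (p x)) = g x * (p x / sqrt (p x))" by simp
    ultimately show "p x * (g x / sqrt (p x)) = g x * sqrt (p x)" by simp
  qed
  then show "(LINT x|M0. g x / sqrt (p x)) = (LINT x|M. g x * sqrt (p x))"
    unfolding M0_def by (subst integral_density) (use pos in auto)
qed

text \<open>Where \<open>p\<close> is positive, multiplication by \<open>p\<close> cancels the
  denominators and the integrands agree up to the factor 4. The inequality accounts for the set
  where \<open>p\<close> is 0, which the null law does not see. The choice \<open>h = 0\<close>
  shows that the likelihood root is square integrable.\<close>

lemma likelihood_root_error:
  fixes M :: "'a measure" and p q h :: "'a \<Rightarrow> real"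
  defines "M0 \<equiv> density M (\<lambda>x. ennreal (p x))"
  assumes [measurable]: "p \<in> borel_measurable M" "q \<in> borel_measurable M" "h \<in> borel_measurable M"
    and p: "\<And>x. x \<in> space M \<Longrightarrow> 0 \<le> p x"
    and int: "integrable M (\<lambda>x. (sqrt (q x) - sqrt (p x) - h x)\<^sup>2)"
  shows "integrable M0 (\<lambda>x. (2 * (sqrt (q x / p x) - 1) - 2 * h x / sqrt (p x))\<^sup>2)"
    and "(LINT x|M0. (2 * (sqrt (q x / p x) - 1) - 2 * h x / sqrt (p x))\<^sup>2)
      \<le> 4 * (LINT x|M. (sqrt (q x) - sqrt (p x) - h x)\<^sup>2)"
proof -
  let ?F = "\<lambda>x. p x * (2 * (sqrt (q x / p x) - 1) - 2 * h x / sqrt (p x))\<^sup>2"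
  have pos: "AE x in M. 0 \<le> p x" using p by auto
  have F: "0 \<le> ?F x" "?F x \<le> 4 * (sqrt (q x) - sqrt (p x) - h x)\<^sup>2" if "x \<in> space M" for x
  proof -
    show "0 \<le> ?F x" using p[OF that] by simp
    show "?F x \<le> 4 * (sqrt (q x) - sqrt (p x) - h x)\<^sup>2"
    proof (cases "p x = 0")
      case False
      then have "0 < p x" using p[OF that] by simp
      then have "2 * (sqrt (q x / p x) - 1) - 2 * h x / sqrt (p x) = 2 * (sqrt (q x) - sqrt (p x) - h x) / sqrt (p x)"
        by (simp add: real_sqrt_divide diff_divide_distrib right_diff_distrib)
      then have "?F x = p x * ((2 * (sqrt (q x) - sqrt (p x) - h x))\<^sup>2 / (sqrt (p x))\<^sup>2)"
        by (simp only: power_divide)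
      also have "\<dots> = 4 * (sqrt (q x) - sqrt (p x) - h x)\<^sup>2"
        using \<open>0 < p x\<close> by (simp only: power_mult_distrib) simp
      finally show ?thesis by simp
    qed simp
  qed
  have i: "integrable M ?F"
    by (rule Bochner_Integration.integrable_bound[of M "\<lambda>x. 4 * (sqrt (q x) - sqrt (p x) - h x)\<^sup>2"])
      (use int F in \<open>auto intro!: AE_I2\<close>)
  then show "integrable M0 (\<lambda>x. (2 * (sqrt (q x / p x) - 1) - 2 * h x / sqrt (p x))\<^sup>2)"
    unfolding M0_def by (subst integrable_density) (use pos in auto)
  have "(LINT x|M. ?F x) \<le> (LINT x|M. 4 * (sqrt (q x) - sqrt (p x) - h x)\<^sup>2)"
    using i int F by (intro integral_mono) auto
  then show "(LINT x|M0. (2 * (sqrt (q x / p x) - 1) - 2 * h x / sqrt (p x))\<^sup>2)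
      \<le> 4 * (LINT x|M. (sqrt (q x) - sqrt (p x) - h x)\<^sup>2)"
    unfolding M0_def by (subst integral_density) (use pos in auto)
qed

lemma log_ennreal_ennreal: "0 < x \<Longrightarrow> log_ennreal (ennreal x) = ereal (ln x)"
  by (simp add: log_ennreal_def)

section \<open>Expansion for a sequence of alternatives with a scalar tangent\<close>

text \<open>The sphere geometry provides the centring and the mean shift required by the expansion
  for independent samples. Off its bad event every ratio \<open>q / p\<close> is positive, so the
  extended logarithm is finite and equals the sum of real logarithms.\<close>

lemma log_likelihood_ratio_expansion:
  fixes M :: "'a measure" and p g :: "'a \<Rightarrow> real" and q :: "nat \<Rightarrow> 'a \<Rightarrow> real" and \<epsilon> :: real
  defines "P \<equiv> \<lambda>n::nat. Pi\<^sub>M {..<n} (\<lambda>_. density M (\<lambda>x. ennreal (p x)))"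
    and "Q \<equiv> \<lambda>n::nat. Pi\<^sub>M {..<n} (\<lambda>_. density M (\<lambda>x. ennreal (q n x)))"
  assumes p_meas[measurable]: "p \<in> borel_measurable M" and p: "\<And>x. x \<in> space M \<Longrightarrow> 0 \<le> p x"
    and P: "prob_space (density M (\<lambda>x. ennreal (p x)))"
    and q: "\<forall>\<^sub>F n in sequentially. q n \<in> borel_measurable M \<and> (\<forall>x\<in>space M. 0 \<le> q n x) \<and>
      prob_space (density M (\<lambda>x. ennreal (q n x)))"
    and g_meas[measurable]: "g \<in> borel_measurable M" and g: "integrable M (\<lambda>x. (g x)\<^sup>2)"
    and g0: "AE x in M. p x = 0 \<longrightarrow> g x = 0"
    and lim: "(\<lambda>n. n * (LINT x|M. (sqrt (q n x) - sqrt (p x) - g x / sqrt n)\<^sup>2)) \<longlonglongrightarrow> 0"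
    and \<epsilon>: "0 < \<epsilon>"
  shows "(\<lambda>n. measure (P n) {\<omega> \<in> space (P n). \<bar>log_ennreal (lik_ratio (P n) (Q n) \<omega>)
      - ereal ((\<Sum>i<n. 2 * (g (\<omega> i) / sqrt (p (\<omega> i)))) / sqrt n - 4 * (LINT x|M. (g x)\<^sup>2) / 2)\<bar> > ereal \<epsilon>}) \<longlonglongrightarrow> 0"
proof -
  define M0 where "M0 = density M (\<lambda>x. ennreal (p x))"
  interpret M0: prob_space M0 unfolding M0_def by (rule P)
  define s w \<sigma>2 where "s x = 2 * (g x / sqrt (p x))" and "w n x = 2 * (sqrt (q n x / p x) - 1)"
    and "\<sigma>2 = 4 * (LINT x|M. (g x)\<^sup>2)" for x n
  have pos: "AE x in M. 0 \<le> p x" using p by auto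
  have borel: "borel_measurable M0 = borel_measurable M" by (simp add: M0_def measurable_density_eq1 cong: measurable_cong_sets)
  have s_meas: "s \<in> borel_measurable M0" unfolding borel s_def[abs_def] by measurable
  note div_sqrt = density_div_sqrt[OF p_meas g_meas g_meas p g g g0, folded M0_def]
  have s2: "integrable M0 (\<lambda>x. (s x)\<^sup>2)" and \<sigma>2: "M0.expectation (\<lambda>x. (s x)\<^sup>2) = \<sigma>2"
  proof -
    have "(s x)\<^sup>2 = 4 * (g x / sqrt (p x) * (g x / sqrt (p x)))" for x
      by (simp add: s_def power2_eq_square)
    moreover have "\<sigma>2 = 4 * (LINT x|M. g x * g x)" by (simp add: \<sigma>2_def power2_eq_square)
    ultimately show "integrable M0 (\<lambda>x. (s x)\<^sup>2)" "M0.expectation (\<lambda>x. (s x)\<^sup>2) = \<sigma>2"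
      using div_sqrt(1,2) by (simp_all only: integral_mult_right_zero integrable_mult_right)
  qed
  have s0: "M0.expectation s = 0"
    using div_sqrt(3) DQM_mean_zero[OF p_meas p P q g_meas g lim] by (simp only: s_def[abs_def] integral_mult_right_zero)
  have root: "\<forall>\<^sub>F n in sequentially. w n \<in> borel_measurable M \<and> integrable M0 (\<lambda>x. (w n x)\<^sup>2)
      \<and> n * M0.expectation (\<lambda>x. (w n x - s x / sqrt n)\<^sup>2)
        \<le> 4 * (n * (LINT x|M. (sqrt (q n x) - sqrt (p x) - g x / sqrt n)\<^sup>2))
      \<and> M0.expectation (w n) = 2 * (LINT x|M. sqrt (q n x) * sqrt (p x)) - 2"
    using q
  proof eventually_elim
    case (elim n)
    then have qn[measurable]: "q n \<in> borel_measurable M" by simp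
    have hell: "integrable M (\<lambda>x. (sqrt (p x))\<^sup>2)" "integrable M (\<lambda>x. (sqrt (q n x))\<^sup>2)"
      "integrable M (\<lambda>x. sqrt (q n x) * sqrt (p x))"
      using Hellinger_affinity(1-3)[of p M "q n"] elim p P by auto
    have qp: "integrable M (\<lambda>x. (sqrt (q n x) - sqrt (p x))\<^sup>2)"
      by (rule integrable_add_L2) (use hell in auto)
    have "integrable M (\<lambda>x. (sqrt (q n x) - sqrt (p x) - g x / sqrt n)\<^sup>2)"
      by (rule integrable_add_L2(2)) (use qp g in \<open>auto simp: power_divide\<close>)
    note le = likelihood_root_error(2)[OF p_meas qn _ p this, folded M0_def]
    have w2: "integrable M0 (\<lambda>x. (w n x)\<^sup>2)"
      using likelihood_root_error(1)[OF p_meas qn _ p, of "\<lambda>_. 0", folded M0_def] qp by (simp add: w_def)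
    have "(LINT x|M. p x * w n x) = (LINT x|M. 2 * (sqrt (q n x) * sqrt (p x)) - 2 * p x)"
    proof (rule Bochner_Integration.integral_cong[OF refl])
      fix x assume x: "x \<in> space M"
      have "p x * sqrt (q n x / p x) = sqrt (q n x) * (p x / sqrt (p x))" by (simp add: real_sqrt_divide)
      also have "p x / sqrt (p x) = sqrt (p x)" using p[OF x] by (simp add: real_div_sqrt)
      finally show "p x * w n x = 2 * (sqrt (q n x) * sqrt (p x)) - 2 * p x"
        by (simp add: w_def algebra_simps)
    qed
    also have "\<dots> = 2 * (LINT x|M. sqrt (q n x) * sqrt (p x)) - 2"
      using hell prob_density_integral[OF p_meas p P] by simp
    also have "(LINT x|M. p x * w n x) = M0.expectation (w n)"
      unfolding M0_def by (subst integral_density) (use pos in \<open>auto simp: w_def[abs_def]\<close>)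
    finally have "M0.expectation (w n) = 2 * (LINT x|M. sqrt (q n x) * sqrt (p x)) - 2" .
    moreover have "n * M0.expectation (\<lambda>x. (w n x - s x / sqrt n)\<^sup>2)
        \<le> n * (4 * (LINT x|M. (sqrt (q n x) - sqrt (p x) - g x / sqrt n)\<^sup>2))"
      using le by (intro mult_left_mono) (auto simp: w_def s_def mult.commute)
    moreover have "w n \<in> borel_measurable M" unfolding w_def[abs_def] by measurable
    ultimately show ?case using w2 by simp
  qed
  have lim': "(\<lambda>n. n * M0.expectation (\<lambda>x. (w n x - s x / sqrt n)\<^sup>2)) \<longlonglongrightarrow> 0"
  proof (rule Lim_null_comparison)
    show "(\<lambda>n. 4 * (n * (LINT x|M. (sqrt (q n x) - sqrt (p x) - g x / sqrt n)\<^sup>2))) \<longlonglongrightarrow> 0"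
      using tendsto_mult_left[OF lim, of 4] by simp
    show "\<forall>\<^sub>F n in sequentially. norm (n * M0.expectation (\<lambda>x. (w n x - s x / sqrt n)\<^sup>2))
        \<le> 4 * (n * (LINT x|M. (sqrt (q n x) - sqrt (p x) - g x / sqrt n)\<^sup>2))"
      using root by eventually_elim (simp add: abs_mult)
  qed
  have mean: "(\<lambda>n. n * M0.expectation (w n)) \<longlonglongrightarrow> - \<sigma>2 / 4"
    by (rule Lim_transform_eventually[of "\<lambda>n. n * (2 * (LINT x|M. sqrt (q n x) * sqrt (p x)) - 2)"])
      (use DQM_affinity[OF p_meas p P q g_meas g lim] root in \<open>auto simp: \<sigma>2_def elim!: eventually_mono\<close>)
  define B where "B n = {\<omega> \<in> space (P n). \<not> ((\<forall>i<n. \<bar>w n (\<omega> i)\<bar> \<le> 1) \<and>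
      \<bar>(\<Sum>i<n. 2 * ln (1 + w n (\<omega> i) / 2)) - ((\<Sum>i<n. s (\<omega> i)) / sqrt n - \<sigma>2 / 2)\<bar> \<le> \<epsilon>)}" for n
  have "(\<lambda>n. measure (P n) (B n)) \<longlonglongrightarrow> 0"
    unfolding B_def P_def M0_def[symmetric]
    by (rule M0.iid_log_expansion[OF s_meas s2 s0 \<sigma>2 _ lim' mean \<epsilon>])
      (use root in \<open>auto simp: borel elim!: eventually_mono\<close>)
  then show ?thesis
  proof (rule Lim_null_comparison[rotated])
    let ?R = "\<lambda>n \<omega>. \<bar>log_ennreal (lik_ratio (P n) (Q n) \<omega>)
      - ereal ((\<Sum>i<n. 2 * (g (\<omega> i) / sqrt (p (\<omega> i)))) / sqrt n - 4 * (LINT x|M. (g x)\<^sup>2) / 2)\<bar>"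
    show "\<forall>\<^sub>F n in sequentially. norm (measure (P n) {\<omega> \<in> space (P n). ?R n \<omega> > ereal \<epsilon>}) \<le> measure (P n) (B n)"
      using root q
    proof eventually_elim
      case (elim n)
      interpret Pn: prob_space "P n" unfolding P_def M0_def[symmetric] by (rule M0.prob_space_iid)
      have [measurable]: "w n \<in> borel_measurable M0" "s \<in> borel_measurable M0"
        using elim s_meas by (auto simp: borel)
      have B: "B n \<in> sets (P n)" unfolding B_def P_def M0_def[symmetric] by measurable
      have qn: "q n \<in> borel_measurable M" "\<And>x. x \<in> space M \<Longrightarrow> 0 \<le> q n x"
        "prob_space (density M (\<lambda>x. ennreal (q n x)))"
        using elim by auto
      have lik: "AE \<omega> in P n. lik_ratio (P n) (Q n) \<omega> = (\<Prod>i<n. ennreal (q n (\<omega> i) / p (\<omega> i)))"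
        "AE \<omega> in P n. \<forall>i<n. 0 < p (\<omega> i)"
        unfolding P_def Q_def
        by (rule lik_ratio_iid(2)[OF p_meas qn(1) p qn(2) P qn(3)]; assumption)
          (rule lik_ratio_iid(3)[OF p_meas qn(1) p qn(2) P qn(3)]; assumption)
      \<comment> \<open>The inclusion of events can hold only almost surely, as the likelihood ratio
        is determined only up to null sets.\<close>
      have "AE \<omega> in P n. \<omega> \<in> {\<omega> \<in> space (P n). ?R n \<omega> > ereal \<epsilon>} \<longrightarrow> \<omega> \<in> B n"
        using lik
      proof eventually_elim
        case (elim \<omega>)
        show ?case
        proof (rule impI, rule ccontr)
          assume R: "\<omega> \<in> {\<omega> \<in> space (P n). ?R n \<omega> > ereal \<epsilon>}" and "\<omega> \<notin> B n"
          then have w: "\<And>i. i < n \<Longrightarrow> \<bar>w n (\<omega> i)\<bar> \<le> 1"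
            and ex: "\<bar>(\<Sum>i<n. 2 * ln (1 + w n (\<omega> i) / 2)) - ((\<Sum>i<n. s (\<omega> i)) / sqrt n - \<sigma>2 / 2)\<bar> \<le> \<epsilon>"
            by (auto simp: B_def)
          define r where "r i = q n (\<omega> i) / p (\<omega> i)" for i
          have root_r: "1 + w n (\<omega> i) / 2 = sqrt (r i)" for i by (simp add: w_def r_def diff_divide_distrib)
          \<comment> \<open>From \<open>\<bar>w\<bar> \<le> 1\<close> the root of the ratio is at
            least 1/2, so the value minus infinity of the logarithm is excluded.\<close>
          have r: "0 < r i" if "i < n" for i
          proof -
            have "0 < 1 + w n (\<omega> i) / 2" using w[OF that] by auto
            then show ?thesis unfolding root_r by simp
          qed
          have "(\<Prod>i<n. ennreal (r i)) = ennreal (\<Prod>i<n. r i)"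
            by (rule prod_ennreal) (use r in \<open>auto intro: order_less_imp_le\<close>)
          then have "lik_ratio (P n) (Q n) \<omega> = ennreal (\<Prod>i<n. r i)"
            using elim(1) by (simp only: r_def)
          moreover have "0 < (\<Prod>i<n. r i)" using r by (intro prod_pos) auto
          ultimately have "log_ennreal (lik_ratio (P n) (Q n) \<omega>) = ereal (ln (\<Prod>i<n. r i))"
            by (simp only: log_ennreal_ennreal)
          also have "ln (\<Prod>i<n. r i) = (\<Sum>i<n. ln (r i))"
            by (rule ln_prod) (use r in force)+
          also have "\<dots> = (\<Sum>i<n. 2 * ln (1 + w n (\<omega> i) / 2))"
          proof (rule sum.cong[OF refl])
            fix i assume "i \<in> {..<n}"
            then have "0 < r i" using r by simp
            then show "ln (r i) = 2 * ln (1 + w n (\<omega> i) / 2)" by (simp add: root_r ln_sqrt)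
          qed
          finally have "?R n \<omega> = ereal \<bar>(\<Sum>i<n. 2 * ln (1 + w n (\<omega> i) / 2)) - ((\<Sum>i<n. s (\<omega> i)) / sqrt n - \<sigma>2 / 2)\<bar>"
            by (simp add: s_def \<sigma>2_def)
          with R ex show False by simp
        qed
      qed
      then show ?case using Pn.finite_measure_mono_AE[OF _ B] by simp
    qed
  qed
qed

subsection \<open>The quadratic expansion\<close>

lemma inner_block:
  fixes b :: "real^'p"
  shows "block a b \<bullet> x = a * x $ None + (\<Sum>j\<in>UNIV. b $ j * x $ Some j)"
proof -
  have "block a b \<bullet> x = (\<Sum>i\<in>insert None (range Some). block a b $ i * x $ i)"
    by (simp add: inner_vec_def UNIV_option_conv)
  also have "\<dots> = a * x $ None + (\<Sum>j\<in>UNIV. b $ j * x $ Some j)"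
    by (subst sum.insert) (auto simp: block_def sum.reindex)
  finally show ?thesis .
qed

lemma block_scaleR: "block (c * a) (c *\<^sub>R b) = c *\<^sub>R block a b"
  by (simp add: block_def vec_eq_iff split: option.split)

text \<open>The increment in \<xi> enters the DQM direction squared, so the rates n^(-1/4) and
  n^(-1/2) both become n^(-1/2) and the direction is \<open>t / sqrt n\<close>. An error that is
  small compared with its squared norm is then o(1/n).\<close>

lemma DQM_local_path:
  fixes p :: "'x \<Rightarrow> real \<Rightarrow> real^'p \<Rightarrow> real" and \<xi>0 \<delta>1 :: real and \<theta> \<delta>2 :: "real^'p"
  defines "\<xi>n \<equiv> \<lambda>n::nat. \<xi>0 + \<delta>1 * real n powr (-1/4)"
    and "\<theta>n \<equiv> \<lambda>n::nat. \<theta> + (real n powr (-1/2)) *\<^sub>R \<delta>2"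
  assumes \<xi>0: "\<xi>0 \<in> interior \<Xi>"
    and \<theta>n: "\<forall>\<^sub>F n in sequentially. \<theta>n n \<in> \<Theta>"
    and DQM: "modified_DQM \<mu> p \<Xi> \<Theta> \<xi>0 \<theta> v"
  shows "\<forall>\<^sub>F n in sequentially. \<xi>n n \<in> \<Xi> \<and> \<theta>n n \<in> \<Theta>"
    and "(\<lambda>n. n * (LINT x|\<mu>. (sqrt (p x (\<xi>n n) (\<theta>n n)) - sqrt (p x \<xi>0 \<theta>)
      - (block (\<delta>1\<^sup>2) \<delta>2 \<bullet> v x) / sqrt n)\<^sup>2)) \<longlonglongrightarrow> 0"
proof -
  define t where "t = block (\<delta>1\<^sup>2) \<delta>2"
  define z where "z n = (\<xi>n n, \<theta>n n)" for n
  have "(\<lambda>n. real n powr (-1/4)) \<longlonglongrightarrow> 0" by real_asymp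
  from tendsto_add[OF tendsto_const tendsto_mult_right_zero[OF this], of \<xi>0 \<delta>1]
  have \<xi>_lim: "\<xi>n \<longlonglongrightarrow> \<xi>0" by (simp add: \<xi>n_def)
  have "(\<lambda>n. real n powr (-1/2)) \<longlonglongrightarrow> 0" by real_asymp
  from tendsto_add[OF tendsto_const tendsto_scaleR[OF this tendsto_const], of \<theta> \<delta>2]
  have "\<theta>n \<longlonglongrightarrow> \<theta>" by (simp add: \<theta>n_def)
  with \<xi>_lim have z: "filterlim z (nhds (\<xi>0, \<theta>)) sequentially"
    unfolding z_def[abs_def] by (intro tendsto_Pair)
  \<comment> \<open>The interior point takes care of \<xi>; for \<theta> membership is assumed along
    the path, as \<open>\<Theta>\<close> need not be open.\<close>
  have "\<forall>\<^sub>F n in sequentially. \<xi>n n \<in> interior \<Xi>"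
    using \<xi>_lim \<xi>0 by (auto simp: tendsto_def)
  with \<theta>n show in_set: "\<forall>\<^sub>F n in sequentially. \<xi>n n \<in> \<Xi> \<and> \<theta>n n \<in> \<Theta>"
    by eventually_elim (use interior_subset in auto)
  define I H where "I = (\<lambda>(\<xi>, \<theta>'). LINT x|\<mu>. (sqrt (p x \<xi> \<theta>') - sqrt (p x \<xi>0 \<theta>)
      - block ((\<xi> - \<xi>0)\<^sup>2) (\<theta>' - \<theta>) \<bullet> v x)\<^sup>2)"
    and "H = (\<lambda>(\<xi>, \<theta>'). (norm (block ((\<xi> - \<xi>0)\<^sup>2) (\<theta>' - \<theta>)))\<^sup>2)"
  have I: "I \<in> o[at (\<xi>0, \<theta>) within \<Xi> \<times> \<Theta>](H)"
    using DQM by (simp add: modified_DQM_def I_def H_def)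
  have step: "block ((\<xi>n n - \<xi>0)\<^sup>2) (\<theta>n n - \<theta>) = (1 / sqrt n) *\<^sub>R t" if "0 < n" for n
  proof -
    have r: "real n powr (-1/2) = 1 / sqrt n"
      using powr_minus[of "real n" "1/2"] by (simp add: powr_half_sqrt inverse_eq_divide)
    have "(real n powr (-1/4))\<^sup>2 = real n powr (-1/4 + -1/4)"
      unfolding power2_eq_square by (rule powr_add[symmetric])
    then have "(real n powr (-1/4))\<^sup>2 = 1 / sqrt n" by (simp add: r[simplified])
    then have "(\<xi>n n - \<xi>0)\<^sup>2 = 1 / sqrt n * \<delta>1\<^sup>2"
      by (simp add: \<xi>n_def power_mult_distrib)
    moreover have "\<theta>n n - \<theta> = (1 / sqrt n) *\<^sub>R \<delta>2" unfolding \<theta>n_def r by simp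
    ultimately show ?thesis by (simp only: t_def block_scaleR)
  qed
  have "(\<lambda>n. n * I (z n)) \<longlonglongrightarrow> 0"
  proof (rule LIMSEQ_I)
    fix \<epsilon> :: real assume "0 < \<epsilon>"
    \<comment> \<open>The summand 1 keeps the denominator positive and the final estimate strict
      even when \<open>t = 0\<close>.\<close>
    define c where "c = \<epsilon> / (1 + (norm t)\<^sup>2)"
    have t: "0 < 1 + (norm t)\<^sup>2" by (simp add: add_pos_nonneg)
    have c: "0 < c" unfolding c_def using \<open>0 < \<epsilon>\<close> t by (rule divide_pos_pos)
    have "\<forall>\<^sub>F y in nhds (\<xi>0, \<theta>). y \<noteq> (\<xi>0, \<theta>) \<longrightarrow> y \<in> \<Xi> \<times> \<Theta> \<longrightarrow> norm (I y) \<le> c * norm (H y)"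
      using landau_o.smallD[OF I c] by (simp add: eventually_at_filter)
    then have "\<forall>\<^sub>F n in sequentially. z n \<noteq> (\<xi>0, \<theta>) \<longrightarrow> z n \<in> \<Xi> \<times> \<Theta> \<longrightarrow> norm (I (z n)) \<le> c * norm (H (z n))"
      by (rule eventually_compose_filterlim[OF _ z])
    then have "\<forall>\<^sub>F n in sequentially. norm (real n * I (z n) - 0) < \<epsilon>"
      using in_set eventually_gt_at_top[of 0]
    proof eventually_elim
      case (elim n)
      \<comment> \<open>The little-o statement excludes the base point, but the path stays there
        when both increments are zero.\<close>
      have "I (\<xi>0, \<theta>) = 0" by (simp add: I_def inner_block)
      then have "norm (I (z n)) \<le> c * norm (H (z n))"
        using elim c by (cases "z n = (\<xi>0, \<theta>)") (auto simp: z_def)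
      also have "H (z n) = (norm t)\<^sup>2 / n"
        using step[OF elim(3)] by (simp add: H_def z_def power_divide)
      finally have "n * norm (I (z n)) \<le> c * (norm t)\<^sup>2" using elim(3) by (simp add: field_simps)
      also have "\<dots> < c * (1 + (norm t)\<^sup>2)" using c by simp
      also have "\<dots> = \<epsilon>" using t by (simp add: c_def)
      finally show ?case by (simp add: abs_mult)
    qed
    then show "\<exists>N. \<forall>n\<ge>N. norm (real n * I (z n) - 0) < \<epsilon>" by (simp add: eventually_sequentially)
  qed
  then show "(\<lambda>n. n * (LINT x|\<mu>. (sqrt (p x (\<xi>n n) (\<theta>n n)) - sqrt (p x \<xi>0 \<theta>)
      - (block (\<delta>1\<^sup>2) \<delta>2 \<bullet> v x) / sqrt n)\<^sup>2)) \<longlonglongrightarrow> 0"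
  proof (rule Lim_transform_eventually)
    show "\<forall>\<^sub>F n in sequentially. n * I (z n) = n * (LINT x|\<mu>. (sqrt (p x (\<xi>n n) (\<theta>n n)) - sqrt (p x \<xi>0 \<theta>)
      - (block (\<delta>1\<^sup>2) \<delta>2 \<bullet> v x) / sqrt n)\<^sup>2)"
      using eventually_gt_at_top[of 0]
      by eventually_elim (simp add: I_def z_def step t_def)
  qed
qed

lemma inner_information:
  fixes v :: "'x \<Rightarrow> real^('p::finite option)"
  assumes "\<And>i j. integrable \<mu> (\<lambda>x. v x $ i * v x $ j)"
  shows "t \<bullet> (information \<mu> v *v t) = 4 * (LINT x|\<mu>. (t \<bullet> v x)\<^sup>2)"
proof -
  have "(t \<bullet> v x)\<^sup>2 = (\<Sum>i\<in>UNIV. \<Sum>j\<in>UNIV. t $ i * t $ j * (v x $ i * v x $ j))" for x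
    by (simp add: inner_vec_def power2_eq_square sum_product mult_ac)
  then have "(LINT x|\<mu>. (t \<bullet> v x)\<^sup>2) = (LINT x|\<mu>. (\<Sum>i\<in>UNIV. \<Sum>j\<in>UNIV. t $ i * t $ j * (v x $ i * v x $ j)))"
    by simp
  also have "\<dots> = (\<Sum>i\<in>UNIV. LINT x|\<mu>. (\<Sum>j\<in>UNIV. t $ i * t $ j * (v x $ i * v x $ j)))"
    using assms by (intro Bochner_Integration.integral_sum Bochner_Integration.integrable_sum) auto
  also have "\<dots> = (\<Sum>i\<in>UNIV. \<Sum>j\<in>UNIV. t $ i * t $ j * (LINT x|\<mu>. v x $ i * v x $ j))"
    using assms by (intro sum.cong refl) (subst Bochner_Integration.integral_sum; auto)
  finally have "4 * (LINT x|\<mu>. (t \<bullet> v x)\<^sup>2)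
      = (\<Sum>i\<in>UNIV. \<Sum>j\<in>UNIV. 4 * (t $ i * t $ j * (LINT x|\<mu>. v x $ i * v x $ j)))"
    by (simp only: sum_distrib_left)
  then show ?thesis
    by (simp add: information_def inner_vec_def matrix_vector_mult_def sum_distrib_left mult_ac)
qed

text \<open>The path condition \<open>local_seq\<close> ranges over all directions \<open>d\<close>:
  the expansion uses the path of \<open>\<delta>2\<close>, while centring each component of the
  score uses paths along the coordinate axes.\<close>

theorem theorem1:
  fixes \<mu> :: "'x measure"
    and p p1 p2 :: "'x \<Rightarrow> real \<Rightarrow> real^'p \<Rightarrow> real"
    and g :: "'x \<Rightarrow> real \<Rightarrow> real^'p \<Rightarrow> real^'p"
    and \<Xi> :: "real set" and \<Theta> :: "(real^'p) set"
    and \<xi>0 \<delta>1 :: real and \<theta> \<delta>2 :: "real^'p"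
    and v :: "'x \<Rightarrow> real^('p option)"
  defines "P \<equiv> \<lambda>n. joint \<mu> p n \<xi>0 \<theta>"
    and "S \<equiv> score p \<xi>0 \<theta> v"
    and "J \<equiv> information \<mu> v"
    and "t \<equiv> block (\<delta>1\<^sup>2) \<delta>2"
    and "\<xi>n \<equiv> \<lambda>n::nat. \<xi>0 + \<delta>1 * real n powr (-1/4)"
    and "\<theta>n \<equiv> \<lambda>n::nat. \<theta> + (real n powr (-1/2)) *\<^sub>R \<delta>2"
  assumes model: "density_family \<mu> p \<Xi> \<Theta>"
    and smooth: "regularity \<mu> p p1 p2 g \<Xi> \<Theta> \<xi>0"
    and \<theta>: "\<theta> \<in> \<Theta>"
    and local_seq: "\<And>d::real^'p. \<forall>\<^sub>F n::nat in sequentially. \<theta> + (real n powr (-1/2)) *\<^sub>R d \<in> \<Theta>"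
    and DQM: "modified_DQM \<mu> p \<Xi> \<Theta> \<xi>0 \<theta> v"
    and v: "AE x in \<mu>. v x =
      block (1/4 * (p2 x \<xi>0 \<theta> / sqrt (p x \<xi>0 \<theta>)) * (if p x \<xi>0 \<theta> > 0 then 1 else 0))
            ((1/2 * (1 / sqrt (p x \<xi>0 \<theta>)) * (if p x \<xi>0 \<theta> > 0 then 1 else 0)) *\<^sub>R g x \<xi>0 \<theta>)"
  shows "small_o_prob P
      (\<lambda>n \<omega>. log_lik_ratio \<mu> p n \<xi>0 \<theta> (\<xi>n n) (\<theta>n n) \<omega> - ereal (t \<bullet> S n \<omega> - 1/2 * (t \<bullet> (J *v t)))) \<and>
    (\<forall>n\<ge>1.
      (\<forall>i j. integrable (P n) (\<lambda>\<omega>. S n \<omega> $ i) \<and> integrable (P n) (\<lambda>\<omega>. S n \<omega> $ i * S n \<omega> $ j)) \<and>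
      J $ None $ None = (LINT \<omega>|P n. (S n \<omega> $ None)\<^sup>2) \<and>
      (\<forall>j. J $ None $ Some j = covariance (P n) (\<lambda>\<omega>. S n \<omega> $ None) (\<lambda>\<omega>. S n \<omega> $ Some j)) \<and>
      (\<forall>i. J $ Some i $ None = covariance (P n) (\<lambda>\<omega>. S n \<omega> $ Some i) (\<lambda>\<omega>. S n \<omega> $ None)) \<and>
      (\<forall>i j. J $ Some i $ Some j = (LINT \<omega>|P n. S n \<omega> $ Some i * S n \<omega> $ Some j)))"
proof -
  have \<xi>0: "\<xi>0 \<in> interior \<Xi>" using smooth by (simp add: regularity_def)
  then have \<xi>0': "\<xi>0 \<in> \<Xi>" using interior_subset by auto
  define p0 where "p0 x = p x \<xi>0 \<theta>" for x
  have p0_meas[measurable]: "p0 \<in> borel_measurable \<mu>" and p0: "\<And>x. x \<in> space \<mu> \<Longrightarrow> 0 \<le> p0 x"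
    and M0: "prob_space (density \<mu> (\<lambda>x. ennreal (p0 x)))"
    using model \<xi>0' \<theta> unfolding density_family_def marginal_def p0_def[abs_def] by auto
  have P_eq: "P n = Pi\<^sub>M {..<n} (\<lambda>_. density \<mu> (\<lambda>x. ennreal (p0 x)))" for n
    by (simp add: P_def joint_def marginal_def p0_def)
  have v_meas[measurable]: "v \<in> borel_measurable \<mu>" and v2: "integrable \<mu> (\<lambda>x. (norm (v x))\<^sup>2)"
    using DQM by (auto simp: modified_DQM_def)
  have tv_meas: "(\<lambda>x. u \<bullet> v x) \<in> borel_measurable \<mu>" for u by measurable
  have tv2: "integrable \<mu> (\<lambda>x. (u \<bullet> v x)\<^sup>2)" for u
  proof (rule Bochner_Integration.integrable_bound[of \<mu> "\<lambda>x. (norm u)\<^sup>2 * (norm (v x))\<^sup>2"])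
    have "(u \<bullet> v x)\<^sup>2 \<le> (norm u)\<^sup>2 * (norm (v x))\<^sup>2" for x
      using Cauchy_Schwarz_ineq[of u "v x"] by (simp add: power2_norm_eq_inner)
    then show "AE x in \<mu>. norm ((u \<bullet> v x)\<^sup>2) \<le> norm ((norm u)\<^sup>2 * (norm (v x))\<^sup>2)"
      by (intro AE_I2) simp
  qed (use v2 in auto)
  have v0: "AE x in \<mu>. p0 x = 0 \<longrightarrow> v x = 0"
    using v by eventually_elim (simp add: p0_def block_def vec_eq_iff split: option.split)
  have tv0: "AE x in \<mu>. p0 x = 0 \<longrightarrow> u \<bullet> v x = 0" for u
    using v0 by eventually_elim simp
  have path: "(\<forall>\<^sub>F n in sequentially. \<xi>0 + d1 * real n powr (-1/4) \<in> \<Xi> \<and> \<theta> + (real n powr (-1/2)) *\<^sub>R d2 \<in> \<Theta>) \<and>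
      (\<forall>\<^sub>F n in sequentially. (\<lambda>x. p x (\<xi>0 + d1 * real n powr (-1/4)) (\<theta> + (real n powr (-1/2)) *\<^sub>R d2)) \<in> borel_measurable \<mu>
        \<and> (\<forall>x\<in>space \<mu>. 0 \<le> p x (\<xi>0 + d1 * real n powr (-1/4)) (\<theta> + (real n powr (-1/2)) *\<^sub>R d2))
        \<and> prob_space (density \<mu> (\<lambda>x. ennreal (p x (\<xi>0 + d1 * real n powr (-1/4)) (\<theta> + (real n powr (-1/2)) *\<^sub>R d2)))))"
    for d1 and d2 :: "real^'p"
  proof -
    have "\<forall>\<^sub>F n in sequentially. \<xi>0 + d1 * real n powr (-1/4) \<in> \<Xi> \<and> \<theta> + (real n powr (-1/2)) *\<^sub>R d2 \<in> \<Theta>"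
      by (rule DQM_local_path(1)[OF \<xi>0 local_seq DQM])
    moreover from this have "\<forall>\<^sub>F n in sequentially. (\<lambda>x. p x (\<xi>0 + d1 * real n powr (-1/4)) (\<theta> + (real n powr (-1/2)) *\<^sub>R d2)) \<in> borel_measurable \<mu>
        \<and> (\<forall>x\<in>space \<mu>. 0 \<le> p x (\<xi>0 + d1 * real n powr (-1/4)) (\<theta> + (real n powr (-1/2)) *\<^sub>R d2))
        \<and> prob_space (density \<mu> (\<lambda>x. ennreal (p x (\<xi>0 + d1 * real n powr (-1/4)) (\<theta> + (real n powr (-1/2)) *\<^sub>R d2))))"
      by eventually_elim (use model in \<open>auto simp: density_family_def marginal_def\<close>)
    ultimately show ?thesis by blast
  qed
  note lim = DQM_local_path(2)[OF \<xi>0 local_seq DQM, folded p0_def]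
  have mean_zero: "(LINT x|\<mu>. (block (d1\<^sup>2) d2 \<bullet> v x) * sqrt (p0 x)) = 0" for d1 and d2 :: "real^'p"
    by (rule DQM_mean_zero[OF p0_meas p0 M0 path[THEN conjunct2, of d1 d2] tv_meas tv2 lim])
  \<comment> \<open>Each component of \<open>v\<close> is itself the tangent of an admissible path:
    \<open>d1 = 1\<close>, \<open>d2 = 0\<close> for the \<xi>-component, and \<open>d1 = 0\<close>
    with a unit vector \<open>d2\<close> for a \<theta>-component.\<close>
  have v_mean: "(LINT x|\<mu>. v x $ i * sqrt (p0 x)) = 0" for i
  proof (cases i)
    case None
    then show ?thesis using mean_zero[of 1 0] by (simp add: inner_block)
  next
    case (Some j)
    have "block 0 (axis j 1) \<bullet> v x = v x $ i" for x
      by (simp add: inner_block Some axis_def if_distrib[of "\<lambda>z. z * _"] cong: if_cong)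
    then show ?thesis using mean_zero[of 0 "axis j 1"] by simp
  qed
  have vi_meas[measurable]: "(\<lambda>x. v x $ i) \<in> borel_measurable \<mu>" for i
    using tv_meas[of "axis i 1"] by (simp add: inner_axis')
  have vi2: "integrable \<mu> (\<lambda>x. (v x $ i)\<^sup>2)" for i
    using tv2[of "axis i 1"] by (simp add: inner_axis')
  have vi0: "AE x in \<mu>. p0 x = 0 \<longrightarrow> v x $ i = 0" for i
    using v0 by eventually_elim simp
  have quad: "t \<bullet> (J *v t) = 4 * (LINT x|\<mu>. (t \<bullet> v x)\<^sup>2)"
    unfolding J_def by (intro inner_information integrable_mult_L2 vi_meas vi2)
  \<comment> \<open>Projecting on \<open>t\<close> reduces the vector statement to the scalar one
    with tangent \<open>t \<bullet> v\<close>.\<close>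
  have S_inner: "t \<bullet> S n \<omega> = (\<Sum>i<n. 2 * ((t \<bullet> v (\<omega> i)) / sqrt (p0 (\<omega> i)))) / sqrt n" for n \<omega>
    by (simp add: S_def score_def p0_def inner_sum_right sum_distrib_left sum_divide_distrib mult.commute)
  have Q_eq: "joint \<mu> p n \<xi> \<theta>' = Pi\<^sub>M {..<n} (\<lambda>_. density \<mu> (\<lambda>x. ennreal (p x \<xi> \<theta>')))" for n \<xi> \<theta>'
    by (simp add: joint_def marginal_def)
  interpret M0: prob_space "density \<mu> (\<lambda>x. ennreal (p0 x))" by (rule M0)

  have "small_o_prob P
      (\<lambda>n \<omega>. log_lik_ratio \<mu> p n \<xi>0 \<theta> (\<xi>n n) (\<theta>n n) \<omega> - ereal (t \<bullet> S n \<omega> - 1/2 * (t \<bullet> (J *v t))))"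
    unfolding small_o_prob_def
  proof (intro conjI allI impI)
    show "\<forall>\<^sub>F n in sequentially. (\<lambda>\<omega>. log_lik_ratio \<mu> p n \<xi>0 \<theta> (\<xi>n n) (\<theta>n n) \<omega>
        - ereal (t \<bullet> S n \<omega> - 1/2 * (t \<bullet> (J *v t)))) \<in> borel_measurable (P n)"
      using path[THEN conjunct2, of \<delta>1 \<delta>2]
    proof eventually_elim
      case (elim n)
      then have "lik_ratio (P n) (joint \<mu> p n (\<xi>n n) (\<theta>n n)) \<in> borel_measurable (P n)"
        unfolding P_eq Q_eq \<xi>n_def \<theta>n_def by (intro lik_ratio_iid(1) p0_meas p0 M0) auto
      then have [measurable]: "log_lik_ratio \<mu> p n \<xi>0 \<theta> (\<xi>n n) (\<theta>n n) \<in> borel_measurable (P n)"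
        unfolding log_lik_ratio_def P_def by measurable
      have [measurable]: "(\<lambda>x. (t \<bullet> v x) / sqrt (p0 x)) \<in> borel_measurable (density \<mu> (\<lambda>x. ennreal (p0 x)))"
        by measurable
      have [measurable]: "(\<lambda>\<omega>. t \<bullet> S n \<omega>) \<in> borel_measurable (P n)"
        unfolding S_inner P_eq by measurable
      show ?case by measurable
    qed
    fix \<epsilon> :: real assume "0 < \<epsilon>"
    show "(\<lambda>n. measure (P n) {\<omega> \<in> space (P n). \<bar>log_lik_ratio \<mu> p n \<xi>0 \<theta> (\<xi>n n) (\<theta>n n) \<omega>
        - ereal (t \<bullet> S n \<omega> - 1/2 * (t \<bullet> (J *v t)))\<bar> > ereal \<epsilon>}) \<longlonglongrightarrow> 0"
      using log_likelihood_ratio_expansion[OF p0_meas p0 M0 path[THEN conjunct2, of \<delta>1 \<delta>2] tv_meas[of t] tv2 tv0 lim[of \<delta>1 \<delta>2, folded t_def] \<open>0 < \<epsilon>\<close>]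
      unfolding log_lik_ratio_def P_def[symmetric] S_inner quad P_eq Q_eq \<xi>n_def \<theta>n_def by (simp add: p0_def)
  qed
  \<comment> \<open>The condition \<open>1 \<le> n\<close> is essential: the score of the empty
    sample is 0, whereas \<open>J\<close> need not be.\<close>
  moreover have "integrable (P n) (\<lambda>\<omega>. S n \<omega> $ i) \<and> integrable (P n) (\<lambda>\<omega>. S n \<omega> $ i * S n \<omega> $ j)
      \<and> (LINT \<omega>|P n. S n \<omega> $ i) = 0 \<and> (LINT \<omega>|P n. S n \<omega> $ i * S n \<omega> $ j) = J $ i $ j" if "1 \<le> n" for n i j
  proof -
    define f where "f k x = v x $ k / sqrt (p0 x)" for k x
    have f_meas: "f k \<in> borel_measurable (density \<mu> (\<lambda>x. ennreal (p0 x)))" for k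
      unfolding f_def[abs_def] by measurable
    note ds = density_div_sqrt[OF p0_meas vi_meas vi_meas p0 vi2 vi2 vi0, folded f_def]
    have f2: "integrable (density \<mu> (\<lambda>x. ennreal (p0 x))) (\<lambda>x. (f k x)\<^sup>2)" for k
      using ds(1)[of k k] by (simp add: power2_eq_square)
    have f0: "M0.expectation (f k) = 0" for k
      using ds(3)[of k] v_mean by (simp add: f_def[abs_def])
    have f1: "integrable (density \<mu> (\<lambda>x. ennreal (p0 x))) (f k)" for k
      by (rule M0.square_integrable_imp_integrable[OF f_meas f2])
    have S: "S n \<omega> $ k = 2 / sqrt n * (\<Sum>i<n. f k (\<omega> i))" for k \<omega>
      by (simp add: S_def score_def f_def p0_def sum_component)
    have SS: "S n \<omega> $ i * S n \<omega> $ j = 4 / n * ((\<Sum>k<n. f i (\<omega> k)) * (\<Sum>k<n. f j (\<omega> k)))" for \<omega>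
    proof -
      have "2 / sqrt n * a * (2 / sqrt n * b) = 4 / (sqrt n * sqrt n) * (a * b)" for a b :: real
        by simp
      then show ?thesis by (simp add: S)
    qed
    note sum = M0.iid_sum[OF f1, where n = n, folded P_eq]
      and sum_mult = M0.iid_sum_mult[OF f_meas f_meas f2 f2 f0, where n = n, folded P_eq]
    have "(LINT \<omega>|P n. S n \<omega> $ i * S n \<omega> $ j) = 4 * M0.expectation (\<lambda>x. f i x * f j x)"
      unfolding SS integral_mult_right_zero sum_mult(2) using that by simp
    also have "\<dots> = J $ i $ j" using ds(2)[of i j] by (simp add: J_def information_def)
    finally have "(LINT \<omega>|P n. S n \<omega> $ i * S n \<omega> $ j) = J $ i $ j" .
    moreover have "integrable (P n) (\<lambda>\<omega>. S n \<omega> $ i * S n \<omega> $ j)"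
      unfolding SS by (rule integrable_mult_right) (rule sum_mult(1))
    moreover have "integrable (P n) (\<lambda>\<omega>. S n \<omega> $ i)"
      unfolding S by (rule integrable_mult_right) (rule sum(1))
    moreover have "(LINT \<omega>|P n. S n \<omega> $ i) = 0"
      unfolding S integral_mult_right_zero sum(2) f0 by simp
    ultimately show ?thesis by simp
  qed
  \<comment> \<open>All score components have mean zero, so covariances are plain product
    moments.\<close>
  moreover from this have "covariance (P n) (\<lambda>\<omega>. S n \<omega> $ i) (\<lambda>\<omega>. S n \<omega> $ j) = J $ i $ j" if "1 \<le> n" for n i j
    using that by (simp add: covariance_def)
  ultimately show ?thesis by (simp add: power2_eq_square)
qed

end
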